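(* Let $A,B\subset\mathbb{R}^n$ be closed solid convex sets with $A\cap B\neq\emptyset$, and consider the GAP iteration $x_{k+1}=\Pi_A^{\alpha_2}\Pi_B^{\alpha_1}x_k$ (i.e. $\alpha=1$) with $1<\alpha_1,\alpha_2<2$. Then the iterates converge to some point $x^*\in A\cap B$. If moreover $(A,B)$ satisfies condition (C) at $x^*$, then either the problem is solved in finite time (some $x_k\in A\cap B$), or $x^*\in\operatorname{bd}A\cap\operatorname{bd}B$ and eventually the algorithm identifies $(\operatorname{bd}A,\operatorname{bd}B)$, i.e. there is $K$ such that for all $k\ge K$ the iterates coincide with those obtained when $A$ and $B$ are replaced by $\operatorname{bd}A$ and $\operatorname{bd}B$, and the iterates converge R-linearly to $x^*$ with any rate $\mu\in(\gamma(S_{T(x^* )}),1)$, where $S_{T(x^* )}:=\Pi^{\alpha_2}_{T_{\operatorname{bd}A}(x^* )}\Pi^{\alpha_1}_{T_{\operatorname{bd}B}(x^* )}$.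
   Context: Solid means nonempty interior. $\Pi_C$ is the projection onto $C$, $\Pi_C^\alpha:=(1-\alpha)I+\alpha\Pi_C$. A set $\mathcal{M}$ is a $\mathcal{C}^k$-manifold around $x$ if there is an open $U\ni x$ with $\mathcal{M}\cap U=\{y:F(y)=0\}$ for a $\mathcal{C}^k$ map $F:U\to\mathbb{R}^d$ with surjective derivative throughout $U$; $T_{\mathcal{M}}(x)=\ker DF(x)$. Two manifolds $\mathcal{M},\mathcal{N}$ satisfy the regularity assumption at $x\in\mathcal{M}\cap\mathcal{N}$ if they are $\mathcal{C}^k$-smooth ($k\ge2$) around $x$, $\mathcal{M}\cap\mathcal{N}$ is a $\mathcal{C}^k$ manifold around $x$, and $T_{\mathcal{M}\cap\mathcal{N}}(x)=T_{\mathcal{M}}(x)\cap T_{\mathcal{N}}(x)$. Condition (C) at $x^*\in A\cap B$: at least one of (C1) $x^*\in\operatorname{bd}A\cap\operatorname{bd}B$ and $(\operatorname{bd}A,\operatorname{bd}B)$ satisfy the regularity assumption at $x^*$; (C2) $x^*\in\operatorname{int}A\cap\operatorname{bd}B$ with $\operatorname{bd}B$ a $\mathcal{C}^2$ manifold around $x^*$; (C3) $x^*\in\operatorname{bd}A\cap\operatorname{int}B$ with $\operatorname{bd}A$ a $\mathcal{C}^2$ manifold around $x^*$; (C4) $x^*\in\operatorname{int}A\cap\operatorname{int}B$. For a matrix $M$ with spectral radius at most $1$, $\gamma(M):=\max\{|\lambda| : \lambda\in\{0\}\cup(\Lambda(M)\setminus\{1\})\}$, $\Lambda(M)$ the set of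 eigenvalues. R-linear convergence with any rate $\mu\in(\gamma,1)$: for every such $\mu$ there is $C>0$ with $\|x_k-x^*\|\le C\mu^k$ for all $k$. *)

theory Defs
  imports "HOL-Analysis.Analysis"
begin

definition relproj :: "real \<Rightarrow> 'a::euclidean_space set \<Rightarrow> 'a \<Rightarrow> 'a" where
  "relproj \<alpha> C x = (1 - \<alpha>) *\<^sub>R x + \<alpha> *\<^sub>R closest_point C x"

text \<open>Set-valued (possibly multivalued) projection onto an arbitrary set, and its relaxation;
  used for the projections onto the (nonconvex) boundaries.\<close>
definition nearest_points :: "'a::euclidean_space set \<Rightarrow> 'a \<Rightarrow> 'a set" where
  "nearest_points S x = {p \<in> S. \<forall>z\<in>S. dist x p \<le> dist x z}"

definition relproj_set :: "real \<Rightarrow> 'a::euclidean_space set \<Rightarrow> 'a \<Rightarrow> 'a set" where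
  "relproj_set \<alpha> S x = {(1 - \<alpha>) *\<^sub>R x + \<alpha> *\<^sub>R p | p. p \<in> nearest_points S x}"

definition C2_on :: "'a::euclidean_space set \<Rightarrow> ('a \<Rightarrow> real) \<Rightarrow> bool" where
  "C2_on U f \<longleftrightarrow>
     (\<forall>y\<in>U. f differentiable (at y)) \<and>
     (\<forall>y\<in>U. (\<lambda>z. Blinfun (frechet_derivative f (at z))) differentiable (at y)) \<and>
     continuous_on U (\<lambda>z. Blinfun (frechet_derivative
        (\<lambda>w. Blinfun (frechet_derivative f (at w))) (at z)))"

text \<open>A local defining map F : U -> R^d for M around x, given by its d component functions
  F 0, ..., F (d-1); surjectivity of DF(y) : R^n -> R^d is stated literally.\<close>
definition manifold_chart ::
  "'a::euclidean_space set \<Rightarrow> 'a \<Rightarrow> 'a set \<Rightarrow> nat \<Rightarrow> (nat \<Rightarrow> 'a \<Rightarrow> real) \<Rightarrow> bool" where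
  "manifold_chart M x U d F \<longleftrightarrow>
     open U \<and> x \<in> U \<and> (\<forall>i<d. C2_on U (F i)) \<and>
     M \<inter> U = {y \<in> U. \<forall>i<d. F i y = 0} \<and>
     (\<forall>y\<in>U. \<forall>c::nat \<Rightarrow> real. \<exists>v. \<forall>i<d. frechet_derivative (F i) (at y) v = c i)"

definition C2_manifold_around :: "'a::euclidean_space set \<Rightarrow> 'a \<Rightarrow> bool" where
  "C2_manifold_around M x \<longleftrightarrow> (\<exists>U d F. manifold_chart M x U d F)"

definition tangent_space :: "'a::euclidean_space set \<Rightarrow> 'a \<Rightarrow> 'a set" where
  "tangent_space M x =
     (case (SOME (d, F). \<exists>U. manifold_chart M x U d F) of (d, F) \<Rightarrow>
        {v. \<forall>i<d. frechet_derivative (F i) (at x) v = 0})"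

definition regularity_assumption :: "'a::euclidean_space set \<Rightarrow> 'a set \<Rightarrow> 'a \<Rightarrow> bool" where
  "regularity_assumption M N x \<longleftrightarrow>
     C2_manifold_around M x \<and> C2_manifold_around N x \<and> C2_manifold_around (M \<inter> N) x \<and>
     tangent_space (M \<inter> N) x = tangent_space M x \<inter> tangent_space N x"

definition condition_C :: "'a::euclidean_space set \<Rightarrow> 'a set \<Rightarrow> 'a \<Rightarrow> bool" where
  "condition_C A B x \<longleftrightarrow>
     (x \<in> frontier A \<inter> frontier B \<and> regularity_assumption (frontier A) (frontier B) x) \<or>
     (x \<in> interior A \<inter> frontier B \<and> C2_manifold_around (frontier B) x) \<or>
     (x \<in> frontier A \<inter> interior B \<and> C2_manifold_around (frontier A) x) \<or>
     (x \<in> interior A \<inter> interior B)"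

text \<open>Complex eigenvalues of a real linear map f (eigenvalues of its complexification):
  f(u + i w) = (a + i b)(u + i w) with u + i w \<noteq> 0.\<close>
definition complex_eigenvalues :: "('a::euclidean_space \<Rightarrow> 'a) \<Rightarrow> complex set" where
  "complex_eigenvalues f = {z. \<exists>u w. (u \<noteq> 0 \<or> w \<noteq> 0) \<and>
      f u = Re z *\<^sub>R u - Im z *\<^sub>R w \<and> f w = Im z *\<^sub>R u + Re z *\<^sub>R w}"

definition gamma_rate :: "('a::euclidean_space \<Rightarrow> 'a) \<Rightarrow> real" where
  "gamma_rate f = Max (cmod ` ({0} \<union> (complex_eigenvalues f - {1})))"

end

(* Near a boundary point where a convex set C has a unique outer unit normal n, the outward directions
   (w - P_C w)/|w - P_C w| tend to n as w tends to the point, so dist(., C) is strictly differentiable there along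
   points outside C, with gradient n. Since n^perp is the tangent space of a C^2 boundary, over-relaxation
   lands inside C near such a point. Hence, unless some iterate solves the problem, x_k eventually lies outside B
   and P_B^{alpha1} x_k outside A, which is the identification. The distances d_k = dist(x_k, B) and
   e_k = dist(P_B^{alpha1} x_k, A) then satisfy, with c the inner product of the two normals,
     d_{k+1} = (1 - alpha1) d_k - alpha2 c e_k + o(d_k + e_k),
     e_{k+1} = (1 - alpha2) e_k - alpha1 c d_{k+1} + o(d_k + e_k).
   For c >= 0 this contradicts d_k, e_k >= 0. For -1 < c < 0 the characteristic roots of the system are
   eigenvalues of S_T different from 1, which gives the rate. For c = -1 the regularity assumption forces bd B
   into bd A near the limit, so that e_k <= (alpha1 - 1) d_k, and the ratio is the eigenvalue
   (1 - alpha1)(1 - alpha2) of S_T. *)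

theory Submission
  imports Defs
begin

section \<open>Relaxed projections and convergence\<close>

text \<open>Measuring progress by the two distances removes the eigenvalue 1. Each step of the
  iteration is a combination of the two residuals, so its length is at most 2 (d_k + e_k). S_T fixes
  the common tangent directions, but motion along them enters the recurrence only through the
  o-terms, and a geometric bound on d_k + e_k is summed to a rate for the points. The limit depends
  on the starting point, so it is supplied beforehand by Fejer monotonicity, and every local
  estimate is made at that limit. The obstacle is tangency. For c = -1 the two tangent hyperplanes
  coincide and the characteristic roots are 1 and (1 - \<alpha>1)(1 - \<alpha>2), so the o-terms
  decide: first-order data cannot tell two touching balls from two halfspaces with a common
  boundary. Regularity makes the intersection of the boundaries a manifold of codimension one; it
  therefore fills bd B near the limit, and the foot of x_k on B lies in A. The factor \<alpha>1 - 1
  is the overshoot beyond this foot.\<close>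

definition resid :: "'a::euclidean_space set \<Rightarrow> 'a \<Rightarrow> 'a" where
  "resid C w = w - closest_point C w"

lemma relproj_resid: "relproj \<alpha> C w = w - \<alpha> *\<^sub>R resid C w"
  by (simp add: relproj_def resid_def algebra_simps)

lemma resid_eq_0: "w \<in> C \<Longrightarrow> resid C w = 0"
  by (simp add: resid_def closest_point_self)

lemma relproj_id: "w \<in> C \<Longrightarrow> relproj \<alpha> C w = w"
  by (simp add: relproj_resid resid_eq_0)

lemma resid_eq_0_iff:
  assumes "closed C" "C \<noteq> {}"
  shows "resid C w = 0 \<longleftrightarrow> w \<in> C"
  using closest_point_in_set[OF assms, of w] by (auto simp: resid_def closest_point_self)

lemma resid_dot:
  assumes "closed C" "convex C" "y \<in> C"
  shows "resid C w \<bullet> (y - closest_point C w) \<le> 0"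
  using closest_point_dot[OF assms(2,1,3)] by (simp add: resid_def)

lemma norm_resid_le:
  assumes "closed C" "y \<in> C"
  shows "norm (resid C w) \<le> norm (w - y)"
  using closest_point_le[OF assms, of w] by (simp add: resid_def dist_norm)

lemma isCont_resid:
  assumes "closed C" "convex C" "C \<noteq> {}"
  shows "isCont (resid C) w"
  unfolding resid_def by (intro continuous_intros continuous_at_closest_point assms)

text \<open>The obtuse angle at the foot makes the residual's inner product with
  \<open>w - z\<close> at least its squared norm. Expanding the square then leaves the gain
  \<alpha>(2 - \<alpha>), positive for 0 < \<alpha> < 2.\<close>

lemma relproj_fejer:
  assumes "closed C" "convex C" "z \<in> C" "0 \<le> \<alpha>"
  shows "(norm (relproj \<alpha> C w - z))\<^sup>2 \<le> (norm (w - z))\<^sup>2 - \<alpha> * (2 - \<alpha>) * (norm (resid C w))\<^sup>2"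
proof -
  let ?r = "resid C w"
  have "?r \<bullet> (w - z) = (norm ?r)\<^sup>2 - ?r \<bullet> (z - closest_point C w)"
    unfolding power2_norm_eq_inner by (simp add: resid_def algebra_simps)
  hence 1: "(norm ?r)\<^sup>2 \<le> ?r \<bullet> (w - z)"
    using resid_dot[OF assms(1-3), of w] by simp
  have "(norm (relproj \<alpha> C w - z))\<^sup>2 = (norm (w - z))\<^sup>2 - 2 * \<alpha> * (?r \<bullet> (w - z)) + \<alpha>\<^sup>2 * (norm ?r)\<^sup>2"
    unfolding power2_norm_eq_inner relproj_resid
    by (simp add: algebra_simps inner_commute power2_eq_square)
  also have "\<dots> \<le> (norm (w - z))\<^sup>2 - 2 * \<alpha> * (norm ?r)\<^sup>2 + \<alpha>\<^sup>2 * (norm ?r)\<^sup>2"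
    using mult_left_mono[OF 1, of "2 * \<alpha>"] assms(4) by simp
  finally show ?thesis by (simp add: algebra_simps power2_eq_square)
qed

text \<open>Squared distances to a common point decrease, and their losses, which tend to 0, bound
  both residuals. A cluster point therefore lies in both sets, and monotonicity of the distance to
  that very point turns the subsequence into the whole sequence.\<close>

lemma alternating_relproj_converges:
  fixes A B :: "'a::euclidean_space set"
  assumes A: "closed A" "convex A" and B: "closed B" "convex B" and ne: "A \<inter> B \<noteq> {}"
    and al: "0 < \<alpha>1" "\<alpha>1 < 2" "0 < \<alpha>2" "\<alpha>2 < 2"
    and iter: "\<And>k. x (Suc k) = relproj \<alpha>2 A (relproj \<alpha>1 B (x k))"
  obtains xs where "xs \<in> A" "xs \<in> B" "x \<longlonglongrightarrow> xs" "(\<lambda>k. relproj \<alpha>1 B (x k)) \<longlonglongrightarrow> xs"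
proof -
  define y where "y k = relproj \<alpha>1 B (x k)" for k
  define c1 where "c1 = \<alpha>1 * (2 - \<alpha>1)"
  define c2 where "c2 = \<alpha>2 * (2 - \<alpha>2)"
  have c: "c1 > 0" "c2 > 0" using al by (auto simp: c1_def c2_def)
  have step: "(norm (x (Suc k) - z))\<^sup>2 + c1 * (norm (resid B (x k)))\<^sup>2 + c2 * (norm (resid A (y k)))\<^sup>2
        \<le> (norm (x k - z))\<^sup>2" if "z \<in> A" "z \<in> B" for z k
    using relproj_fejer[OF B that(2), of \<alpha>1 "x k"] relproj_fejer[OF A that(1), of \<alpha>2 "y k"] al
    by (simp add: iter y_def c1_def c2_def)
  have dec: "decseq (\<lambda>k. norm (x k - z))" if "z \<in> A" "z \<in> B" for z
  proof (rule decseq_SucI)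
    fix k
    have "(norm (x (Suc k) - z))\<^sup>2 \<le> (norm (x k - z))\<^sup>2"
    proof -
      have "0 \<le> c1 * (norm (resid B (x k)))\<^sup>2" "0 \<le> c2 * (norm (resid A (y k)))\<^sup>2" using c by simp_all
      with step[OF that, of k] show ?thesis by linarith
    qed
    thus "norm (x (Suc k) - z) \<le> norm (x k - z)" by (simp add: power2_le_iff_abs_le)
  qed
  obtain z where z: "z \<in> A" "z \<in> B" using ne by auto
  have neA: "A \<noteq> {}" and neB: "B \<noteq> {}" using z by auto
  define v where "v k = (norm (x k - z))\<^sup>2" for k
  obtain l where "(\<lambda>k. norm (x k - z)) \<longlonglongrightarrow> l"
    using decseq_convergent[OF dec[OF z], of 0] by auto
  hence v: "v \<longlonglongrightarrow> l\<^sup>2" unfolding v_def by (intro tendsto_intros)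
  have v0: "(\<lambda>k. v k - v (Suc k)) \<longlonglongrightarrow> 0"
    using tendsto_diff[OF v LIMSEQ_Suc[OF v]] by simp
  have pos: "0 \<le> c1 * (norm (resid B (x k)))\<^sup>2" "0 \<le> c2 * (norm (resid A (y k)))\<^sup>2" for k
    using c by simp_all
  have le: "c1 * (norm (resid B (x k)))\<^sup>2 \<le> v k - v (Suc k)" "c2 * (norm (resid A (y k)))\<^sup>2 \<le> v k - v (Suc k)" for k
    using step[OF z, of k] pos[of k] unfolding v_def by linarith+
  have "(\<lambda>k. c1 * (norm (resid B (x k)))\<^sup>2) \<longlonglongrightarrow> 0"
    using le pos by (intro tendsto_sandwich[OF _ _ tendsto_const v0]) (simp_all add: always_eventually)
  from tendsto_mult[OF tendsto_const[of "1 / c1"] this] c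
  have rB: "(\<lambda>k. (norm (resid B (x k)))\<^sup>2) \<longlonglongrightarrow> 0" by simp
  have "(\<lambda>k. c2 * (norm (resid A (y k)))\<^sup>2) \<longlonglongrightarrow> 0"
    using le pos by (intro tendsto_sandwich[OF _ _ tendsto_const v0]) (simp_all add: always_eventually)
  from tendsto_mult[OF tendsto_const[of "1 / c2"] this] c
  have rA: "(\<lambda>k. (norm (resid A (y k)))\<^sup>2) \<longlonglongrightarrow> 0" by simp
  from tendsto_real_sqrt[OF rB] have rB: "(\<lambda>k. resid B (x k)) \<longlonglongrightarrow> 0"
    by (simp add: tendsto_norm_zero_iff)
  from tendsto_real_sqrt[OF rA] have rA: "(\<lambda>k. resid A (y k)) \<longlonglongrightarrow> 0"
    by (simp add: tendsto_norm_zero_iff)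
  have yx: "(\<lambda>k. y k - x k) \<longlonglongrightarrow> 0"
    using tendsto_scaleR[OF tendsto_const[of "-\<alpha>1"] rB] by (simp add: y_def relproj_resid)
  have "bounded (range x)"
  proof -
    have "norm (x k) \<le> norm (x 0 - z) + norm z" for k
      using decseqD[OF dec[OF z], of 0 k] norm_triangle_sub[of "x k" z] by simp
    thus ?thesis by (auto simp: bounded_iff)
  qed
  then obtain xs r where r: "strict_mono (r :: nat \<Rightarrow> nat)" "(x \<circ> r) \<longlonglongrightarrow> xs"
    using bounded_imp_convergent_subsequence by blast
  have yr: "(\<lambda>k. y (r k)) \<longlonglongrightarrow> xs"
    using tendsto_add[OF LIMSEQ_subseq_LIMSEQ[OF yx r(1)] r(2)] by (simp add: o_def)
  have "(\<lambda>k. resid B (x (r k))) \<longlonglongrightarrow> resid B xs"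
    by (rule isCont_tendsto_compose[OF isCont_resid[OF B neB]]) (use r(2) in \<open>simp add: o_def\<close>)
  hence "resid B xs = 0"
    using LIMSEQ_subseq_LIMSEQ[OF rB r(1)] by (intro LIMSEQ_unique[of "\<lambda>k. resid B (x (r k))"]) (simp_all add: o_def)
  hence xB: "xs \<in> B" using resid_eq_0_iff[OF B(1)] z by auto
  have "(\<lambda>k. resid A (y (r k))) \<longlonglongrightarrow> resid A xs"
    by (rule isCont_tendsto_compose[OF isCont_resid[OF A neA]]) (use yr in \<open>simp add: o_def\<close>)
  hence "resid A xs = 0"
    using LIMSEQ_subseq_LIMSEQ[OF rA r(1)] by (intro LIMSEQ_unique[of "\<lambda>k. resid A (y (r k))"]) (simp_all add: o_def)
  hence xA: "xs \<in> A" using resid_eq_0_iff[OF A(1)] z by auto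
  have "x \<longlonglongrightarrow> xs"
  proof (rule LIMSEQ_I)
    fix e :: real assume "0 < e"
    then obtain N where N: "norm (x (r N) - xs) < e"
      using LIMSEQ_D[OF r(2) \<open>0 < e\<close>] by auto
    show "\<exists>no. \<forall>n\<ge>no. norm (x n - xs) < e"
      using decseqD[OF dec[OF xA xB]] N by (meson le_less_trans)
  qed
  moreover have "y \<longlonglongrightarrow> xs" using tendsto_add[OF yx calculation] by simp
  ultimately show ?thesis using that xA xB unfolding y_def by blast
qed

section \<open>Smooth boundary points of convex sets\<close>

definition unit_normal :: "'a::euclidean_space set \<Rightarrow> 'a \<Rightarrow> 'a \<Rightarrow> bool" where
  "unit_normal C z n \<longleftrightarrow> norm n = 1 \<and> (\<forall>y\<in>C. n \<bullet> (y - z) \<le> 0)"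

text \<open>Smoothness is put in terms of the normal cone, which is to be a single ray: this form
  mentions no chart and passes to limits by compactness.\<close>

definition smooth_boundary_point :: "'a::euclidean_space set \<Rightarrow> 'a \<Rightarrow> 'a \<Rightarrow> bool" where
  "smooth_boundary_point C z n \<longleftrightarrow>
     z \<in> frontier C \<and> unit_normal C z n \<and> (\<forall>m. unit_normal C z m \<longrightarrow> m = n)"

text \<open>A hyperplane separates \<open>z\<close> from the interior; the inequality extends to
  \<open>C\<close> because a solid convex set lies in the closure of its interior. The separation
  puts \<open>C\<close> on the upper side, hence the sign in \<open>- sgn a\<close>.\<close>

lemma unit_normal_exists:
  assumes C: "closed C" "convex C" "interior C \<noteq> {}" and z: "z \<in> frontier C"
  obtains n where "unit_normal C z n"
proof -
  have "z \<notin> interior C" using z by (simp add: frontier_def)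
  then obtain a b where a: "a \<noteq> 0" "a \<bullet> z \<le> b" "\<And>x. x \<in> interior C \<Longrightarrow> b \<le> a \<bullet> x"
    using separating_hyperplane_sets[of "{z}" "interior C"] C by (auto simp: convex_interior)
  have "b \<le> a \<bullet> y" if "y \<in> C" for y
  proof -
    have "C \<subseteq> closure (interior C)"
      using convex_closure_interior[OF C(2,3)] closure_subset by blast
    moreover have "closure (interior C) \<subseteq> {x. b \<le> a \<bullet> x}"
      using a(3) by (intro closure_minimal) (auto simp: closed_halfspace_ge)
    ultimately show ?thesis using that by blast
  qed
  hence "a \<bullet> z \<le> a \<bullet> y" if "y \<in> C" for y using a(2) that by force
  hence "unit_normal C z (- sgn a)"
    using a(1) by (auto simp: unit_normal_def norm_sgn sgn_div_norm inner_diff_right mult_left_mono)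
  thus ?thesis using that by blast
qed

lemma unit_normal_not_interior:
  assumes "unit_normal C z n"
  shows "z \<notin> interior C"
proof
  assume "z \<in> interior C"
  then obtain r where r: "r > 0" "ball z r \<subseteq> C" by (meson mem_interior)
  have n: "norm n = 1" "\<And>y. y \<in> C \<Longrightarrow> n \<bullet> (y - z) \<le> 0" using assms by (auto simp: unit_normal_def)
  have "z + (r / 2) *\<^sub>R n \<in> C" using r n(1) by (auto simp: dist_norm subset_iff)
  from n(2)[OF this] n(1) r(1) show False by (simp add: dot_square_norm)
qed

lemma unit_normal_resid:
  assumes "closed C" "convex C" "C \<noteq> {}" "w \<notin> C"
  shows "unit_normal C (closest_point C w) (sgn (resid C w))"
  using resid_dot[OF assms(1,2), of _ w] resid_eq_0_iff[OF assms(1,3)] assms(4)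
  by (auto simp: unit_normal_def norm_sgn sgn_div_norm mult_nonneg_nonpos)

text \<open>The subgradient inequality for the distance to \<open>C\<close>, whose gradient is \<open>sgn (resid C w)\<close>.\<close>
lemma resid_distance_subgradient:
  assumes C: "closed C" "convex C" "C \<noteq> {}"
  shows "sgn (resid C w) \<bullet> (w' - w) \<le> norm (resid C w') - norm (resid C w)"
proof (cases "w \<in> C")
  case True
  thus ?thesis by (simp add: resid_eq_0)
next
  case False
  let ?n = "sgn (resid C w)"
  have n: "norm ?n = 1" "?n \<bullet> (closest_point C w' - closest_point C w) \<le> 0"
    using unit_normal_resid[OF C False] closest_point_in_set[OF C(1,3)] by (auto simp: unit_normal_def)
  \<comment> \<open>The displacement is the new residual plus the move of the foot minus the old
    residual; the foot cannot move outward along \<open>?n\<close>.\<close>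
  have "?n \<bullet> (w' - w) = ?n \<bullet> resid C w' + ?n \<bullet> (closest_point C w' - closest_point C w) - ?n \<bullet> resid C w"
    by (simp add: resid_def algebra_simps)
  moreover have "?n \<bullet> resid C w' \<le> norm (resid C w')"
    using norm_cauchy_schwarz[of ?n "resid C w'"] n by simp
  moreover have "?n \<bullet> resid C w = norm (resid C w)"
    using False resid_eq_0_iff[OF C(1,3)] by (simp add: sgn_div_norm dot_square_norm power2_eq_square)
  ultimately show ?thesis using n(2) by linarith
qed

lemma closest_point_in_frontier:
  fixes C :: "'a::euclidean_space set"
  assumes C: "closed C" "convex C" "C \<noteq> {}" and w: "w \<notin> C"
  shows "closest_point C w \<in> frontier C"
  using closest_point_in_set[OF C(1,3), of w] unit_normal_not_interior[OF unit_normal_resid[OF C w]] C(1)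
  by (simp add: frontier_def)

text \<open>Compactness: directions staying \<open>e\<close> away from \<open>n\<close> would have a
  limit \<open>l\<close>. The feet converge to \<open>z\<close>, so the normal inequalities pass to
  the limit and \<open>l\<close> is a second unit normal at \<open>z\<close>.\<close>

lemma resid_direction_near_smooth_point:
  assumes C: "closed C" "convex C" and z: "smooth_boundary_point C z n" and e: "0 < e"
  shows "\<forall>\<^sub>F w in nhds z. w \<notin> C \<longrightarrow> norm (sgn (resid C w) - n) < e"
proof (rule ccontr)
  have zC: "z \<in> C" using z C frontier_subset_closed by (auto simp: smooth_boundary_point_def)
  hence ne: "C \<noteq> {}" by auto
  assume "\<not> ?thesis"
  hence "\<exists>w. dist w z < d \<and> w \<notin> C \<and> \<not> norm (sgn (resid C w) - n) < e" if "d > 0" for d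
    using that unfolding eventually_nhds_metric by blast
  hence "\<forall>k::nat. \<exists>w. dist w z < 1 / Suc k \<and> w \<notin> C \<and> \<not> norm (sgn (resid C w) - n) < e"
    by simp
  then obtain w where w: "\<And>k::nat. dist (w k) z < 1 / Suc k" "\<And>k. w k \<notin> C"
    "\<And>k. \<not> norm (sgn (resid C (w k)) - n) < e" by metis
  define m where "m k = sgn (resid C (w k))" for k
  have un: "unit_normal C (closest_point C (w k)) (m k)" for k
    unfolding m_def using unit_normal_resid[OF C ne w(2)] .
  have wz: "w \<longlonglongrightarrow> z"
    using w(1) by (intro metric_tendsto_imp_tendsto[OF LIMSEQ_inverse_real_of_nat])
      (auto intro!: always_eventually less_imp_le simp: inverse_eq_divide)
  have "bounded (range m)" using un by (auto simp: bounded_iff unit_normal_def intro!: exI[of _ 1])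
  then obtain l r where r: "strict_mono (r :: nat \<Rightarrow> nat)" "(m \<circ> r) \<longlonglongrightarrow> l"
    using bounded_imp_convergent_subsequence by blast
  have p: "(\<lambda>k. closest_point C (w k)) \<longlonglongrightarrow> z"
    using isCont_tendsto_compose[OF continuous_at_closest_point[OF C(2,1) ne] wz] closest_point_self[OF zC] by simp
  have pr: "(\<lambda>k. closest_point C (w (r k))) \<longlonglongrightarrow> z"
    using LIMSEQ_subseq_LIMSEQ[OF p r(1)] by (simp add: o_def)
  have mr: "(\<lambda>k. m (r k)) \<longlonglongrightarrow> l" using r(2) by (simp add: o_def)
  have "norm l = 1"
    using tendsto_norm[OF mr] un by (simp add: unit_normal_def LIMSEQ_const_iff)
  moreover have "l \<bullet> (y - z) \<le> 0" if "y \<in> C" for y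
    by (rule LIMSEQ_le_const2[OF tendsto_inner[OF mr tendsto_diff[OF tendsto_const pr]]])
       (use un that in \<open>auto simp: unit_normal_def\<close>)
  ultimately have "l = n" using z by (auto simp: smooth_boundary_point_def unit_normal_def)
  hence "(\<lambda>k. norm (m (r k) - n)) \<longlonglongrightarrow> 0"
    using tendsto_norm[OF tendsto_diff[OF mr tendsto_const[of n]]] by simp
  hence "\<forall>\<^sub>F k in sequentially. norm (m (r k) - n) < e" using e by (rule order_tendstoD)
  thus False using w(3) by (auto simp: m_def eventually_sequentially)
qed

text \<open>If the open ray from \<open>z\<close> along \<open>- n\<close> missed the interior, a
  separating hyperplane would support \<open>C\<close> at \<open>z\<close>. Its normal would then be
  \<open>n\<close>, the only one available, although moving along \<open>- n\<close> strictly
  decreases that functional.\<close>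

lemma smooth_point_inward_normal:
  assumes C: "closed C" "convex C" "interior C \<noteq> {}" and z: "smooth_boundary_point C z n"
  obtains t where "t > 0" "z - t *\<^sub>R n \<in> interior C"
proof (rule ccontr)
  assume no: "\<not> thesis"
  have zC: "z \<in> C" using z C frontier_subset_closed by (auto simp: smooth_boundary_point_def)
  let ?R = "(\<lambda>t. z - t *\<^sub>R n) ` {0<..}"
  have "convex ?R"
  proof (rule convexI)
    fix x y u v :: real and p q assume *: "p \<in> ?R" "q \<in> ?R" "0 \<le> u" "0 \<le> v" "u + v = 1"
    then obtain s t where st: "s > 0" "t > 0" "p = z - s *\<^sub>R n" "q = z - t *\<^sub>R n" by auto
    have "u *\<^sub>R p + v *\<^sub>R q = (u + v) *\<^sub>R z - (u * s + v * t) *\<^sub>R n"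
      by (simp add: st algebra_simps)
    moreover have "u * s + v * t > 0"
      using st(1,2) *(3-5) by (cases "u = 0") (auto intro!: add_pos_nonneg)
    ultimately show "u *\<^sub>R p + v *\<^sub>R q \<in> ?R" using *(5) by auto
  qed
  moreover have "?R \<noteq> {}" by (auto intro: zero_less_one)
  moreover have "interior C \<inter> ?R = {}" using no that by auto
  ultimately obtain g b where g: "g \<noteq> 0" "\<forall>x\<in>interior C. g \<bullet> x \<le> b" "\<forall>x\<in>?R. b \<le> g \<bullet> x"
    using separating_hyperplane_sets[OF convex_interior[OF C(2)], of ?R] C(3) by blast
  have gC: "g \<bullet> y \<le> b" if "y \<in> C" for y
  proof -
    have "C \<subseteq> closure (interior C)"
      using convex_closure_interior[OF C(2,3)] closure_subset by blast
    moreover have "closure (interior C) \<subseteq> {x. g \<bullet> x \<le> b}"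
      using g(2) by (intro closure_minimal) (auto simp: closed_halfspace_le)
    ultimately show ?thesis using that by blast
  qed
  have gt: "b \<le> g \<bullet> z - t * (g \<bullet> n)" if "t > 0" for t
    using bspec[OF g(3) imageI[of t]] that by (simp add: inner_diff_right)
  have "((\<lambda>t. g \<bullet> z - t * (g \<bullet> n)) \<longlongrightarrow> g \<bullet> z - 0 * (g \<bullet> n)) (at_right 0)"
    by (intro tendsto_intros)
  hence gz: "b \<le> g \<bullet> z"
    by (intro tendsto_lowerbound[of _ _ "at_right (0::real)"])
       (auto simp: eventually_at_filter gt intro!: always_eventually)
  have "unit_normal C z (sgn g)"
    using g(1) gC gz by (auto simp: unit_normal_def norm_sgn sgn_div_norm inner_diff_right
        intro!: mult_left_mono intro: order_trans)
  hence "sgn g = n" using z by (simp add: smooth_boundary_point_def)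
  hence "g \<bullet> n = norm g" using g(1) by (auto simp: sgn_div_norm dot_square_norm power2_eq_square)
  with gt[of 1] gC[OF zC] have "norm g \<le> 0" by linarith
  thus False using g(1) by simp
qed

lemma inward_segment_interior:
  fixes C :: "'a::euclidean_space set"
  assumes C: "convex C" and p: "p \<in> C" "p - t *\<^sub>R n \<in> interior C" and s: "0 < s" "s \<le> t"
  shows "p - s *\<^sub>R n \<in> interior C"
proof -
  have "p - (s / t) *\<^sub>R (p - (p - t *\<^sub>R n)) \<in> interior C"
    using s by (intro mem_interior_convex_shrink[OF C p(2) p(1)]) auto
  thus ?thesis using s by simp
qed

text \<open>The relaxed point is the foot moved inward by (\<alpha> - 1) times the distance. Foot
  and direction are close to \<open>z\<close> and \<open>n\<close>, so the inward segment of fixed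
  length \<open>t\<close> stays inside \<open>C\<close>, while the overshoot tends to 0.\<close>

lemma overshoot_near_smooth_point:
  assumes C: "closed C" "convex C" "interior C \<noteq> {}" and z: "smooth_boundary_point C z n" and \<alpha>: "1 \<le> \<alpha>"
  shows "\<forall>\<^sub>F w in nhds z. relproj \<alpha> C w \<in> C"
proof -
  have zC: "z \<in> C" using z C frontier_subset_closed by (auto simp: smooth_boundary_point_def)
  hence ne: "C \<noteq> {}" by auto
  obtain t where t: "t > 0" "z - t *\<^sub>R n \<in> interior C"
    using smooth_point_inward_normal[OF C z] .
  then obtain e where e: "e > 0" "ball (z - t *\<^sub>R n) e \<subseteq> interior C"
    using open_contains_ball[of "interior C"] by auto
  have cp: "((\<lambda>w. closest_point C w) \<longlongrightarrow> z) (nhds z)"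
    using continuous_at_closest_point[OF C(2,1) ne, of z] closest_point_self[OF zC]
      tendsto_at_iff_tendsto_nhds[of "closest_point C" z]
    by (simp add: continuous_at)
  have 1: "\<forall>\<^sub>F w in nhds z. dist (closest_point C w) z < e / 2"
    using tendstoD[OF cp, of "e / 2"] e by simp
  have 2: "\<forall>\<^sub>F w in nhds z. w \<notin> C \<longrightarrow> norm (sgn (resid C w) - n) < e / (2 * t)"
    using resid_direction_near_smooth_point[OF C(1,2) z] e t by simp
  have "((\<lambda>w. (\<alpha> - 1) * norm (resid C w)) \<longlongrightarrow> (\<alpha> - 1) * norm (z - z)) (nhds z)"
    unfolding resid_def by (intro tendsto_intros cp filterlim_ident)
  hence 3: "\<forall>\<^sub>F w in nhds z. (\<alpha> - 1) * norm (resid C w) < t"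
    using t by (intro order_tendstoD) auto
  from 1 2 3 show ?thesis
  proof eventually_elim
    case (elim w)
    show ?case
    proof (cases "w \<in> C")
      case True
      thus ?thesis by (simp add: relproj_id)
    next
      case False
      let ?p = "closest_point C w" and ?n = "sgn (resid C w)" and ?d = "norm (resid C w)"
      have pC: "?p \<in> C" using closest_point_in_set[OF C(1) ne] .
      have d: "?d > 0" using False resid_eq_0_iff[OF C(1) ne] by auto
      have "resid C w = ?d *\<^sub>R ?n" using d by (simp add: sgn_div_norm)
      moreover have "w = ?p + resid C w" by (simp add: resid_def)
      moreover have "(p + d *\<^sub>R v) - \<alpha> *\<^sub>R (d *\<^sub>R v) = p - ((\<alpha> - 1) * d) *\<^sub>R v" for p v :: 'a and d
        by (simp add: algebra_simps)
      ultimately have r: "relproj \<alpha> C w = ?p - ((\<alpha> - 1) * ?d) *\<^sub>R ?n"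
        unfolding relproj_resid by metis
      have "t * norm (?n - n) < t * (e / (2 * t))"
        using elim(2) False t(1) by (intro mult_strict_left_mono) auto
      hence small: "norm (t *\<^sub>R (?n - n)) < e / 2" using t(1) by simp
      have "norm ((z - t *\<^sub>R n) - (?p - t *\<^sub>R ?n)) \<le> norm (z - ?p) + norm (t *\<^sub>R (?n - n))"
        by (rule order_trans[OF eq_refl norm_triangle_ineq]) (simp add: algebra_simps)
      also have "\<dots> < e"
        using elim(1) small by (simp add: dist_norm norm_minus_commute)
      finally have "?p - t *\<^sub>R ?n \<in> interior C" using e by (auto simp: dist_norm)
      hence int: "?p - s *\<^sub>R ?n \<in> interior C" if "0 < s" "s \<le> t" for s
        using inward_segment_interior[OF C(2) pC _ that] by blast
      show ?thesis
      \<comment> \<open>For \<alpha> = 1 the overshoot has length 0 and the point is the foot, which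
        \<open>int\<close> does not cover.\<close>
      proof (cases "\<alpha> = 1")
        case True
        thus ?thesis using r pC by simp
      next
        case False
        hence "relproj \<alpha> C w \<in> interior C"
          unfolding r using \<alpha> d elim(3) by (intro int) auto
        thus ?thesis using interior_subset by blast
      qed
    qed
  qed
qed

section \<open>Boundaries that are manifolds\<close>

text \<open>At \<tau> = R the point is a convex combination of \<open>z\<close> and
  \<open>c + v/R\<close>, so it lies in \<open>C\<close>. If the point at \<tau> = -R lay in
  \<open>C\<close>, then \<open>z\<close> would be strictly between it and the interior point
  \<open>c - v/R\<close>, hence interior. The segment joining the two must cross the boundary; the
  bound \<open>R\<close> does not depend on \<open>s\<close>.\<close>

lemma frontier_point_along_direction:
  fixes C :: "'a::euclidean_space set"
  assumes C: "convex C" and z: "z \<in> frontier C" "z \<in> C"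
    and R: "c + (1 / R) *\<^sub>R v \<in> interior C" "c - (1 / R) *\<^sub>R v \<in> interior C" "R > 0"
    and s: "0 < s" "s * R \<le> 1"
  obtains \<tau> where "\<bar>\<tau>\<bar> \<le> R" "z + s *\<^sub>R (v + \<tau> *\<^sub>R (c - z)) \<in> frontier C"
proof -
  define h where "h \<tau> = z + s *\<^sub>R (v + \<tau> *\<^sub>R (c - z))" for \<tau>
  have "h R = z - (s * R) *\<^sub>R (z - (c + (1 / R) *\<^sub>R v))"
    using R(3) by (simp add: h_def algebra_simps)
  also have "\<dots> \<in> interior C"
    using s R(3) by (intro mem_interior_convex_shrink[OF C R(1) z(2)]) auto
  finally have hR: "h R \<in> C" using interior_subset by blast
  have "h (-R) \<notin> C"
  proof
    assume *: "h (-R) \<in> C"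
    define q where "q = h (-R)"
    \<comment> \<open>The weight that makes \<open>z\<close> the convex combination of
      \<open>q\<close> and \<open>c - v/R\<close>.\<close>
    define e where "e = s * R / (1 + s * R)"
    have sR: "0 < s * R" using s R(3) by simp
    hence e: "0 < e" "e \<le> 1" by (auto simp: e_def)
    have "q - e *\<^sub>R (q - (c - (1 / R) *\<^sub>R v)) \<in> interior C"
      using * by (intro mem_interior_convex_shrink[OF C R(2) _ e]) (simp add: q_def)
    moreover have "q - e *\<^sub>R (q - (c - (1 / R) *\<^sub>R v)) = z"
    proof -
      have "(1 + s * R) *\<^sub>R (q - e *\<^sub>R (q - (c - (1 / R) *\<^sub>R v)))
          = (1 + s * R) *\<^sub>R q - (s * R) *\<^sub>R (q - (c - (1 / R) *\<^sub>R v))"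
        using sR by (simp add: e_def scaleR_diff_right)
      also have "\<dots> = q + (s * R) *\<^sub>R (c - (1 / R) *\<^sub>R v)" by (simp add: algebra_simps)
      also have "\<dots> = (1 + s * R) *\<^sub>R z"
        using R(3) by (simp add: q_def h_def algebra_simps)
      finally show ?thesis using sR by (simp add: real_vector.scale_left_imp_eq)
    qed
    ultimately show False using z by (simp add: frontier_def)
  qed
  moreover have hmem: "h R \<in> h ` {-R..R}" "h (-R) \<in> h ` {-R..R}" using R(3) by auto
  moreover have "connected (h ` {-R..R})"
    unfolding h_def by (intro connected_continuous_image continuous_intros) simp
  ultimately have "h ` {-R..R} \<inter> frontier C \<noteq> {}"
    using hR hmem by (intro connected_Int_frontier) blast+
  then obtain \<tau> where "\<tau> \<in> {-R..R}" "h \<tau> \<in> frontier C" by blast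
  thus ?thesis using that[of \<tau>] by (auto simp: h_def)
qed

text \<open>The boundary is a Lipschitz graph along an inward direction \<open>c - z\<close>; subsequential limits of its
  difference quotients show that the kernel of a defining map has codimension one.\<close>
lemma frontier_tangent_direction:
  fixes C :: "'a::euclidean_space set"
  assumes C: "closed C" "convex C" and z: "z \<in> frontier C" and c: "c \<in> interior C"
    and U: "open U" "z \<in> U"
    and F: "\<And>i. i < d \<Longrightarrow> (F i has_derivative D i) (at z)"
           "\<And>i y. i < d \<Longrightarrow> y \<in> frontier C \<inter> U \<Longrightarrow> F i y = (0::real)"
    and n: "unit_normal C z n"
  obtains \<tau> where "\<And>i. i < d \<Longrightarrow> D i (v + \<tau> *\<^sub>R (c - z)) = 0" "n \<bullet> (v + \<tau> *\<^sub>R (c - z)) \<le> 0"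
proof -
  have zC: "z \<in> C" using z C frontier_subset_closed by auto
  obtain r where r: "r > 0" "ball c r \<subseteq> interior C"
    using c open_contains_ball[of "interior C"] by auto
  \<comment> \<open>Large enough that both points \<open>c + v/R\<close> and \<open>c - v/R\<close>
    stay in the ball around \<open>c\<close>; the summand 1 keeps \<open>R\<close> positive for
    \<open>v = 0\<close>.\<close>
  define R where "R = norm v / r + 1"
  have R0: "R > 0" unfolding R_def using r by (intro add_nonneg_pos) auto
  have "norm v < r * R" using r by (simp add: R_def algebra_simps)
  hence "norm ((1 / R) *\<^sub>R v) < r" using R0 by (simp add: divide_simps mult.commute)
  hence R: "c + (1 / R) *\<^sub>R v \<in> interior C" "c - (1 / R) *\<^sub>R v \<in> interior C"
    using r by (auto simp: dist_norm subset_iff)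
  define s where "s k = 1 / (R * real (Suc k))" for k
  have s: "s k > 0" "s k * R \<le> 1" for k
    using R0 by (auto simp: s_def divide_simps)
  have "\<exists>\<tau>. \<bar>\<tau>\<bar> \<le> R \<and> z + s k *\<^sub>R (v + \<tau> *\<^sub>R (c - z)) \<in> frontier C" for k
    by (rule frontier_point_along_direction[OF C(2) z zC R R0 s[of k]]) blast
  then obtain t where t: "\<And>k. \<bar>t k\<bar> \<le> R" "\<And>k. z + s k *\<^sub>R (v + t k *\<^sub>R (c - z)) \<in> frontier C"
    by metis
  have "bounded (range t)" using t(1) by (auto simp: bounded_iff)
  then obtain \<tau> \<phi> where \<phi>: "strict_mono (\<phi> :: nat \<Rightarrow> nat)" "(t \<circ> \<phi>) \<longlonglongrightarrow> \<tau>"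
    using bounded_imp_convergent_subsequence by blast
  have "(\<lambda>k. 1 / R * inverse (real (Suc k))) \<longlonglongrightarrow> 1 / R * 0"
    by (intro tendsto_mult tendsto_const LIMSEQ_inverse_real_of_nat)
  hence "s \<longlonglongrightarrow> 0" by (simp add: s_def[abs_def] divide_simps)
  hence s0: "(\<lambda>k. s (\<phi> k)) \<longlonglongrightarrow> 0" using LIMSEQ_subseq_LIMSEQ[OF _ \<phi>(1), of s] by (simp add: o_def)
  define g where "g k = v + t (\<phi> k) *\<^sub>R (c - z)" for k
  define w where "w k = z + s (\<phi> k) *\<^sub>R g k" for k
  have g: "g \<longlonglongrightarrow> v + \<tau> *\<^sub>R (c - z)"
    unfolding g_def[abs_def] using \<phi>(2) by (intro tendsto_intros) (simp add: o_def)
  have "w \<longlonglongrightarrow> z + 0 *\<^sub>R (v + \<tau> *\<^sub>R (c - z))"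
    unfolding w_def[abs_def] by (intro tendsto_intros s0 g)
  hence w: "w \<longlonglongrightarrow> z" by simp
  have wf: "w k \<in> frontier C" for k using t(2) by (simp add: w_def g_def)
  have wU: "\<forall>\<^sub>F k in sequentially. w k \<in> U" using topological_tendstoD[OF w U] .
  show ?thesis
  proof (rule that[of \<tau>])
    fix i assume i: "i < d"
    have lin: "bounded_linear (D i)" using F(1)[OF i] has_derivative_bounded_linear by blast
    have Fz: "F i z = 0" using F(2)[OF i] z U by auto
    have D: "(\<lambda>k. D i (g k)) \<longlonglongrightarrow> D i (v + \<tau> *\<^sub>R (c - z))"
      by (rule bounded_linear.tendsto[OF lin g])
    \<comment> \<open>Division by zero gives \<open>q z = 0\<close>, so differentiability becomes
      continuity of \<open>q\<close> at \<open>z\<close>. This composes with \<open>w\<close> even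
      if \<open>w\<close> returns to \<open>z\<close>.\<close>
    define q where "q y = norm (F i y - F i z - D i (y - z)) / norm (y - z)" for y
    have "((\<lambda>y. norm (F i y - F i z - D i (y - z)) / norm (y - z)) \<longlongrightarrow> 0) (at z)"
      using F(1)[OF i] by (simp add: has_derivative_iff_norm)
    hence "(q \<longlongrightarrow> q z) (at z)" by (simp add: q_def[abs_def])
    hence "isCont q z" by (simp add: isCont_def)
    from isCont_tendsto_compose[OF this w] have q: "(\<lambda>k. q (w k)) \<longlonglongrightarrow> 0" by (simp add: q_def)
    have "(\<lambda>k. q (w k) * norm (g k)) \<longlonglongrightarrow> 0 * norm (v + \<tau> *\<^sub>R (c - z))"
      by (intro tendsto_intros q g)
    \<comment> \<open>\<open>F i\<close> vanishes at \<open>z\<close> and at \<open>w k\<close>, so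
      the remainder is the linear term alone and the factor \<open>s (\<phi> k)\<close>
      cancels.\<close>
    moreover have "\<forall>\<^sub>F k in sequentially. q (w k) * norm (g k) = norm (D i (g k))"
      using wU
    proof eventually_elim
      case (elim k)
      have Fw: "F i (w k) = 0" using F(2)[OF i] wf elim by auto
      have "D i (w k - z) = s (\<phi> k) * D i (g k)"
        using linear_cmul[OF bounded_linear.linear[OF lin]] by (simp add: w_def)
      hence "q (w k) = s (\<phi> k) * \<bar>D i (g k)\<bar> / (s (\<phi> k) * norm (g k))"
        using Fw Fz s(1)[of "\<phi> k"] by (simp add: q_def w_def abs_mult)
      thus ?case
        using s(1)[of "\<phi> k"] linear_0[OF bounded_linear.linear[OF lin]] by (cases "g k = 0") auto
    qed
    ultimately have "(\<lambda>k. norm (D i (g k))) \<longlonglongrightarrow> 0 * norm (v + \<tau> *\<^sub>R (c - z))"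
      by (rule Lim_transform_eventually)
    hence "(\<lambda>k. norm (D i (g k))) \<longlonglongrightarrow> 0" by simp
    hence "(\<lambda>k. D i (g k)) \<longlonglongrightarrow> 0" by (rule tendsto_norm_zero_cancel)
    with D show "D i (v + \<tau> *\<^sub>R (c - z)) = 0" using LIMSEQ_unique by blast
  next
    have "n \<bullet> g k \<le> 0" for k
    proof -
      have "w k \<in> C" using wf C(1) frontier_subset_closed by blast
      hence "s (\<phi> k) * (n \<bullet> g k) \<le> 0" using n by (force simp: unit_normal_def w_def)
      thus ?thesis using s(1)[of "\<phi> k"] by (simp add: mult_le_0_iff)
    qed
    thus "n \<bullet> (v + \<tau> *\<^sub>R (c - z)) \<le> 0"
      by (intro LIMSEQ_le_const2[OF tendsto_inner[OF tendsto_const g]]) auto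
  qed
qed

lemma manifold_chart_has_derivative:
  assumes "manifold_chart M z U d F" "i < d"
  shows "(F i has_derivative frechet_derivative (F i) (at z)) (at z)"
  using assms unfolding manifold_chart_def C2_on_def by (auto simp: frechet_derivative_works)

lemma manifold_chart_surj:
  assumes "manifold_chart M z U d F"
  shows "\<exists>v. \<forall>i<d. frechet_derivative (F i) (at z) v = c i"
  using assms by (simp add: manifold_chart_def)

text \<open>Without equations the chart would place an open set inside the boundary of a closed
  set.\<close>

lemma manifold_chart_dim_pos:
  assumes "manifold_chart (frontier C) z U d F" "closed C"
  shows "0 < d"
proof (rule ccontr)
  assume "\<not> 0 < d"
  hence "U \<subseteq> frontier C" "open U" "z \<in> U" using assms by (auto simp: manifold_chart_def)
  moreover have "frontier C \<subseteq> C" using assms frontier_subset_closed by blast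
  ultimately have "z \<in> interior C" "z \<in> frontier C" by (auto intro: interiorI)
  thus False by (simp add: frontier_def)
qed

text \<open>Every vector can be moved into the kernel \<open>T\<close> along \<open>u\<close>, and
  \<open>T\<close> is proper, so \<open>T\<close> complements the line spanned by \<open>u\<close>.
  The functional \<open>n\<close> is nonpositive on the subspace \<open>T\<close>, hence zero there,
  and it does not vanish at \<open>u\<close>; so \<open>T\<close> is its whole kernel.\<close>

lemma frontier_chart_kernel:
  fixes C :: "'a::euclidean_space set"
  assumes C: "closed C" "convex C" "interior C \<noteq> {}" and z: "z \<in> frontier C"
    and ch: "manifold_chart (frontier C) z U d F" and n: "unit_normal C z n"
  shows "{v. \<forall>i<d. frechet_derivative (F i) (at z) v = 0} = {v. n \<bullet> v = 0}"
proof -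
  define T where "T = {v. \<forall>i<d. frechet_derivative (F i) (at z) v = 0}"
  obtain c where c: "c \<in> interior C" using C(3) by auto
  define u where "u = c - z"
  have lin: "linear (frechet_derivative (F i) (at z))" if "i < d" for i
    using manifold_chart_has_derivative[OF ch that] has_derivative_linear by blast
  have T: "subspace T"
    unfolding subspace_def T_def using lin by (auto simp: linear_0 linear_add linear_cmul)
  have dir: "\<exists>\<tau>. v + \<tau> *\<^sub>R u \<in> T \<and> n \<bullet> (v + \<tau> *\<^sub>R u) \<le> 0" for v
  proof -
    have U: "open U" "z \<in> U" "frontier C \<inter> U = {y \<in> U. \<forall>i<d. F i y = 0}"
      using ch by (auto simp: manifold_chart_def)
    show ?thesis
      by (rule frontier_tangent_direction[OF C(1,2) z c U(1,2) manifold_chart_has_derivative[OF ch] _ n, where d=d and v=v])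
         (use U in \<open>auto simp: T_def u_def\<close>)
  qed
  have "T \<noteq> UNIV"
  proof
    assume "T = UNIV"
    obtain v where "\<forall>i<d. frechet_derivative (F i) (at z) v = 1"
      using manifold_chart_surj[OF ch, of "\<lambda>_. 1"] by blast
    moreover have "v \<in> T" using \<open>T = UNIV\<close> by simp
    ultimately show False using manifold_chart_dim_pos[OF ch C(1)] unfolding T_def by fastforce
  qed
  have uT: "u \<notin> T"
  proof
    assume "u \<in> T"
    have "v \<in> T" for v
    proof -
      obtain \<tau> where "v + \<tau> *\<^sub>R u \<in> T" using dir by blast
      from subspace_diff[OF T this subspace_scale[OF T \<open>u \<in> T\<close>, of \<tau>]] show ?thesis by simp
    qed
    thus False using \<open>T \<noteq> UNIV\<close> by auto
  qed
  have tau0: "\<tau> = 0" if "v \<in> T" "v + \<tau> *\<^sub>R u \<in> T" for v \<tau>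
  proof (rule ccontr)
    assume "\<tau> \<noteq> 0"
    have "\<tau> *\<^sub>R u \<in> T" using subspace_diff[OF T that(2,1)] by simp
    from subspace_scale[OF T this, of "1 / \<tau>"] \<open>\<tau> \<noteq> 0\<close> uT show False by simp
  qed
  have le: "n \<bullet> v \<le> 0" if "v \<in> T" for v
  proof -
    obtain \<tau> where \<tau>: "v + \<tau> *\<^sub>R u \<in> T" "n \<bullet> (v + \<tau> *\<^sub>R u) \<le> 0" using dir by blast
    with tau0[OF that \<tau>(1)] show ?thesis by simp
  qed
  have nT: "n \<bullet> v = 0" if "v \<in> T" for v
    using le[OF that] le[OF subspace_neg[OF T that]] by simp
  \<comment> \<open>Otherwise moving \<open>n\<close> itself into \<open>T\<close> along
    \<open>u\<close> would give \<open>n \<bullet> n = 0\<close>.\<close>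
  have nu: "n \<bullet> u \<noteq> 0"
  proof
    assume "n \<bullet> u = 0"
    obtain \<tau> where "n + \<tau> *\<^sub>R u \<in> T" using dir by blast
    from nT[OF this] \<open>n \<bullet> u = 0\<close> have "n \<bullet> n = 0" by (simp add: inner_add_right)
    thus False using n by (simp add: unit_normal_def)
  qed
  have "v \<in> T" if "n \<bullet> v = 0" for v
  proof -
    obtain \<tau> where \<tau>: "v + \<tau> *\<^sub>R u \<in> T" using dir by blast
    hence "\<tau> = 0" using nT[OF \<tau>] that nu by (simp add: inner_add_right)
    thus ?thesis using \<tau> by simp
  qed
  with nT show ?thesis unfolding T_def[symmetric] by blast
qed

text \<open>Opens the choice inside \<open>tangent_space\<close> once and for all, handing over the
  chart that was picked.\<close>

lemma tangent_space_chart: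
  assumes "C2_manifold_around M z"
  obtains U d F where "manifold_chart M z U d F"
    "tangent_space M z = {v. \<forall>i<d. frechet_derivative (F i) (at z) v = 0}"
proof -
  obtain p where p: "p = (SOME (d, F). \<exists>U. manifold_chart M z U d F)" by blast
  have "\<exists>p. case p of (d, F) \<Rightarrow> \<exists>U. manifold_chart M z U d F"
    using assms by (auto simp: C2_manifold_around_def)
  from someI_ex[OF this] have "case p of (d, F) \<Rightarrow> \<exists>U. manifold_chart M z U d F" by (simp add: p)
  then obtain d F U where "p = (d, F)" "manifold_chart M z U d F" by (cases p) auto
  thus ?thesis using that p by (simp add: tangent_space_def)
qed

text \<open>All unit normals at \<open>z\<close> share the kernel of one chart as orthogonal
  complement, so they agree up to sign. The sign is fixed because each of them is negative on
  \<open>c - z\<close> for an interior point \<open>c\<close>.\<close>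

lemma C2_frontier_smooth:
  fixes C :: "'a::euclidean_space set"
  assumes C: "closed C" "convex C" "interior C \<noteq> {}" and z: "z \<in> frontier C"
    and M: "C2_manifold_around (frontier C) z"
  obtains n where "smooth_boundary_point C z n" "tangent_space (frontier C) z = {v. n \<bullet> v = 0}"
proof -
  obtain n where n: "unit_normal C z n" using unit_normal_exists[OF C z] .
  obtain U d F where ch: "manifold_chart (frontier C) z U d F"
    and T: "tangent_space (frontier C) z = {v. \<forall>i<d. frechet_derivative (F i) (at z) v = 0}"
    using tangent_space_chart[OF M] .
  have "m = n" if m: "unit_normal C z m" for m
  proof -
    have "{v. m \<bullet> v = 0} = {v. n \<bullet> v = 0}"
      by (rule trans[OF frontier_chart_kernel[OF C z ch m, symmetric] frontier_chart_kernel[OF C z ch n]])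
    hence eq: "m \<bullet> v = 0 \<longleftrightarrow> n \<bullet> v = 0" for v by (simp add: set_eq_iff)
    have n1: "norm n = 1" "n \<bullet> n = 1" and m1: "norm m = 1" "m \<bullet> m = 1"
      using m n by (auto simp: unit_normal_def dot_square_norm)
    have "n \<bullet> (m - (n \<bullet> m) *\<^sub>R n) = 0" using n1 by (simp add: inner_diff_right)
    hence "m \<bullet> (m - (n \<bullet> m) *\<^sub>R n) = 0" by (rule iffD2[OF eq])
    hence sq: "(n \<bullet> m) * (n \<bullet> m) = 1" using m1 by (simp add: inner_diff_right inner_commute)
    have "(norm (m - (n \<bullet> m) *\<^sub>R n))\<^sup>2 = m \<bullet> m - 2 * (n \<bullet> m) * (n \<bullet> m) + (n \<bullet> m) * (n \<bullet> m) * (n \<bullet> n)"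
      unfolding power2_norm_eq_inner by (simp add: algebra_simps inner_commute)
    also have "\<dots> = 0" unfolding m1 n1 mult.assoc sq by simp
    finally have mn: "m = (n \<bullet> m) *\<^sub>R n" by simp
    obtain c where "c \<in> interior C" using C(3) by auto
    then obtain r where r: "r > 0" "ball c r \<subseteq> C" by (meson mem_interior)
    have lt: "l \<bullet> (c - z) < 0" if "unit_normal C z l" for l
    proof -
      have l: "norm l = 1" "\<And>y. y \<in> C \<Longrightarrow> l \<bullet> (y - z) \<le> 0" using that by (auto simp: unit_normal_def)
      have "c + (r / 2) *\<^sub>R l \<in> C" using r l by (auto simp: dist_norm subset_iff)
      from l(2)[OF this] have "l \<bullet> (c - z) + (r / 2) * (l \<bullet> l) \<le> 0" by (simp add: algebra_simps)
      thus ?thesis using l(1) r by (simp add: dot_square_norm)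
    qed
    have "m \<bullet> (c - z) = (n \<bullet> m) * (n \<bullet> (c - z))" using mn by (metis inner_scaleR_left)
    hence "n \<bullet> m > 0" using lt[OF m] lt[OF n] by (simp add: zero_less_mult_iff mult_less_0_iff)
    hence "n \<bullet> m = 1" using sq by (simp add: square_eq_1_iff)
    thus ?thesis using mn by (metis scaleR_one)
  qed
  hence "smooth_boundary_point C z n" unfolding smooth_boundary_point_def using n z by blast
  thus ?thesis using that T frontier_chart_kernel[OF C z ch n] by simp
qed

section \<open>Codimension-one manifolds inside a convex boundary\<close>

lemma linear_functional_kernel_hyperplane:
  fixes D :: "'a::euclidean_space \<Rightarrow> real"
  assumes "linear D" "norm b = 1" "\<And>v. b \<bullet> v = 0 \<Longrightarrow> D v = 0"
  shows "D v = (b \<bullet> v) * D b"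
proof -
  have "b \<bullet> (v - (b \<bullet> v) *\<^sub>R b) = 0" using assms(2) by (simp add: inner_diff_right dot_square_norm)
  from assms(3)[OF this] show ?thesis using assms(1) by (simp add: linear_diff linear_cmul)
qed

lemma C2_on_directional_derivative_tendsto:
  fixes f :: "'a::euclidean_space \<Rightarrow> real"
  assumes f: "C2_on U f" and U: "open U" "z \<in> U"
  shows "((\<lambda>w. frechet_derivative f (at w) v) \<longlongrightarrow> frechet_derivative f (at z) v) (nhds z)"
proof -
  let ?G = "\<lambda>w. Blinfun (frechet_derivative f (at w))"
  \<comment> \<open>\<open>Blinfun\<close> is faithful on bounded linear maps, which
    differentiability provides on \<open>U\<close>.\<close>
  have app: "blinfun_apply (?G w) v = frechet_derivative f (at w) v" if "w \<in> U" for w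
  proof -
    have "f differentiable (at w)" using f that by (simp add: C2_on_def)
    hence "bounded_linear (frechet_derivative f (at w))"
      by (metis frechet_derivative_works has_derivative_bounded_linear)
    thus ?thesis by (simp add: bounded_linear_Blinfun_apply)
  qed
  have "isCont ?G z" using f U(2) differentiable_imp_continuous_within[of ?G z UNIV] unfolding C2_on_def by blast
  hence "isCont (\<lambda>w. blinfun_apply (?G w) v) z"
    by (rule bounded_bilinear.continuous[OF bounded_bilinear_blinfun_apply _ continuous_const])
  hence "((\<lambda>w. blinfun_apply (?G w) v) \<longlongrightarrow> blinfun_apply (?G z) v) (nhds z)"
    using tendsto_at_iff_tendsto_nhds[of "\<lambda>w. blinfun_apply (?G w) v" z] by (simp add: isCont_def)
  moreover have "\<forall>\<^sub>F w in nhds z. blinfun_apply (?G w) v = frechet_derivative f (at w) v"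
    using eventually_nhds_in_open[OF U] by eventually_elim (rule app)
  ultimately have "((\<lambda>w. frechet_derivative f (at w) v) \<longlongrightarrow> blinfun_apply (?G z) v) (nhds z)"
    by (rule Lim_transform_eventually)
  thus ?thesis by (simp only: app[OF U(2)])
qed

text \<open>By the intermediate value theorem \<open>Z\<close> has a point on every line in direction \<open>b\<close> close to \<open>z\<close>, and such
  a line meets the boundary of \<open>B\<close> at most once near \<open>z\<close>.\<close>
lemma frontier_near_subset_of_tangent_manifold:
  fixes B Z :: "'a::euclidean_space set"
  assumes B: "closed B" "convex B" "interior B \<noteq> {}" and b: "smooth_boundary_point B z b"
    and Z: "C2_manifold_around Z z" "z \<in> Z" "Z \<subseteq> frontier B" "tangent_space Z z = {v. b \<bullet> v = 0}"
  shows "\<forall>\<^sub>F p in nhds z. p \<in> frontier B \<longrightarrow> p \<in> Z"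
proof -
  have b1: "norm b = 1" "b \<bullet> b = 1"
    using b by (auto simp: smooth_boundary_point_def unit_normal_def dot_square_norm)
  have fB: "frontier B \<subseteq> B" using B(1) frontier_subset_closed by blast
  obtain U d F where ch: "manifold_chart Z z U d F"
    and T: "tangent_space Z z = {v. \<forall>i<d. frechet_derivative (F i) (at z) v = 0}"
    using tangent_space_chart[OF Z(1)] .
  define D where "D i = frechet_derivative (F i) (at z)" for i
  have ker: "(\<forall>i<d. D i v = 0) \<longleftrightarrow> b \<bullet> v = 0" for v using T Z(4) by (auto simp: D_def)
  have Dlin: "D i v = (b \<bullet> v) * D i b" if "i < d" for i v
    using manifold_chart_has_derivative[OF ch that] has_derivative_linear b1(1) ker that
    unfolding D_def[symmetric] by (intro linear_functional_kernel_hyperplane) blast+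
  have d0: "0 < d" using ker[of b] b1 by (cases d) auto
  obtain v where v: "\<forall>i<d. D i v = (if i = 0 then 1 else 0)"
    using manifold_chart_surj[OF ch, of "\<lambda>i. if i = 0 then 1 else 0"] by (auto simp: D_def)
  have g0: "D 0 b \<noteq> 0" "b \<bullet> v \<noteq> 0" using Dlin[OF d0, of v] v d0 by auto
  \<comment> \<open>All derivatives \<open>D i\<close> are multiples of one functional, so two of
    them could not be jointly onto: \<open>v\<close> has the values 1 and 0 although both multiples
    are nonzero.\<close>
  have d1: "d = 1"
  proof (rule ccontr)
    assume "d \<noteq> 1"
    hence d: "1 < d" using d0 by simp
    obtain w where "\<forall>i<d. D i w = 1" using manifold_chart_surj[OF ch, of "\<lambda>_. 1"] by (auto simp: D_def)
    with d Dlin[OF d, of w] have "D 1 b \<noteq> 0" by auto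
    moreover have "D 1 v = 0" using v d by simp
    ultimately show False using Dlin[OF d, of v] g0 by simp
  qed
  define f where "f = F 0"
  have U: "open U" "z \<in> U" and f: "C2_on U f" and fZ: "Z \<inter> U = {y \<in> U. f y = 0}"
    using ch d1 by (auto simp: manifold_chart_def f_def)
  \<comment> \<open>Orients the line so that \<open>f\<close> increases along \<open>a\<close>. Half
    the slope at \<open>z\<close> remains a lower bound on the whole ball of radius
    \<open>r\<close>.\<close>
  define \<sigma> where "\<sigma> = sgn (D 0 b)"
  have \<sigma>: "\<sigma> = 1 \<or> \<sigma> = -1" using g0 by (auto simp: \<sigma>_def sgn_real_def)
  define a where "a = \<sigma> *\<^sub>R b"
  have a1: "norm a = 1" using \<sigma> b1 by (auto simp: a_def)
  define \<kappa> where "\<kappa> = \<bar>D 0 b\<bar> / 2"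
  have \<kappa>: "\<kappa> > 0" using g0 by (simp add: \<kappa>_def)
  have "frechet_derivative f (at z) a = \<bar>D 0 b\<bar>"
    using Dlin[OF d0, of a] b1 by (simp add: D_def f_def a_def \<sigma>_def abs_sgn mult.commute)
  hence "\<forall>\<^sub>F w in nhds z. \<kappa> < frechet_derivative f (at w) a"
    using \<kappa> by (intro order_tendstoD[OF C2_on_directional_derivative_tendsto[OF f U]]) (simp add: \<kappa>_def)
  from eventually_conj[OF this eventually_nhds_in_open[OF U]]
  obtain r where r: "r > 0" "\<And>w. dist w z < r \<Longrightarrow> \<kappa> < frechet_derivative f (at w) a \<and> w \<in> U"
    by (auto simp: eventually_nhds_metric)
  obtain t0 where t0: "t0 > 0" "z - t0 *\<^sub>R b \<in> interior B"
    using smooth_point_inward_normal[OF B b] .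
  then obtain \<eta> where \<eta>: "\<eta> > 0" "ball (z - t0 *\<^sub>R b) \<eta> \<subseteq> interior B"
    using open_contains_ball[of "interior B"] by auto
  have inward: "q - s *\<^sub>R b \<in> interior B" if "q \<in> B" "dist q z < \<eta>" "0 < s" "s \<le> t0" for q s
  proof -
    have "q - t0 *\<^sub>R b \<in> ball (z - t0 *\<^sub>R b) \<eta>" using that(2) by (simp add: dist_norm norm_minus_commute)
    thus ?thesis using inward_segment_interior[OF B(2) that(1) _ that(3,4)] \<eta>(2) by blast
  qed
  \<comment> \<open>From a point within \<open>r / 2\<close> and \<open>\<eta> / 2\<close> of
    \<open>z\<close>, walking a length \<rho> keeps the slope bound and the room for
    \<open>inward\<close>.\<close>
  define \<rho> where "\<rho> = min t0 (min (r / 2) (\<eta> / 2))"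
  have \<rho>: "\<rho> > 0" "\<rho> \<le> t0" "\<rho> \<le> r / 2" "\<rho> \<le> \<eta> / 2" using t0 r \<eta> by (auto simp: \<rho>_def)
  have "isCont f z" using f U by (auto simp: C2_on_def intro: differentiable_imp_continuous_within)
  hence "(f \<longlongrightarrow> f z) (nhds z)" using tendsto_at_iff_tendsto_nhds[of f z] by (simp add: isCont_def)
  moreover have "f z = 0" using fZ Z(2) U by auto
  ultimately have "((\<lambda>p. \<bar>f p\<bar>) \<longlongrightarrow> 0) (nhds z)" using tendsto_rabs_zero by force
  \<comment> \<open>So small that a walk of length \<rho> at slope above \<kappa> reaches a zero of
    \<open>f\<close>.\<close>
  hence "\<forall>\<^sub>F p in nhds z. \<bar>f p\<bar> < \<kappa> * \<rho>" using \<kappa> \<rho> by (intro order_tendstoD) auto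
  moreover have "\<forall>\<^sub>F p in nhds z. dist p z < min (r / 2) (\<eta> / 2)"
    using r(1) \<eta>(1) by (auto simp: eventually_nhds_metric intro!: exI[of _ "min (r / 2) (\<eta> / 2)"])
  ultimately show ?thesis
  proof eventually_elim
    case (elim p)
    show ?case
    proof
      assume pB: "p \<in> frontier B"
      define \<phi> where "\<phi> t = f (p + t *\<^sub>R a)" for t
      have near: "dist (p + t *\<^sub>R a) z < r" "dist (p + t *\<^sub>R a) z < \<eta>" if "\<bar>t\<bar> \<le> \<rho>" for t
      proof -
        have "dist (p + t *\<^sub>R a) z \<le> dist p z + norm (t *\<^sub>R a)"
          unfolding dist_norm by (metis add_diff_eq add.commute diff_add_eq norm_triangle_ineq)
        also have "norm (t *\<^sub>R a) \<le> \<rho>" using that a1 by simp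
        finally show "dist (p + t *\<^sub>R a) z < r" "dist (p + t *\<^sub>R a) z < \<eta>" using elim(2) \<rho> by auto
      qed
      have der: "(\<phi> has_derivative (\<lambda>h. frechet_derivative f (at (p + t *\<^sub>R a)) (h *\<^sub>R a))) (at t within S)"
        if "\<bar>t\<bar> \<le> \<rho>" for t S
      proof -
        have "f differentiable (at (p + t *\<^sub>R a))" using f r(2)[OF near(1)[OF that]] by (auto simp: C2_on_def)
        hence fd: "(f has_derivative frechet_derivative f (at (p + t *\<^sub>R a))) (at (p + t *\<^sub>R a))"
          by (simp add: frechet_derivative_works)
        have "((\<lambda>t. p + t *\<^sub>R a) has_derivative (\<lambda>h. h *\<^sub>R a)) (at t within S)"
          by (auto intro!: derivative_eq_intros)
        from has_derivative_compose[OF this fd] show ?thesis by (simp add: \<phi>_def[abs_def])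
      qed
      have incr: "\<kappa> * (t - s) < \<phi> t - \<phi> s" if st: "s < t" "-\<rho> \<le> s" "t \<le> \<rho>" for s t
      proof -
        have "\<exists>x\<in>{s<..<t}. \<phi> t - \<phi> s = frechet_derivative f (at (p + x *\<^sub>R a)) ((t - s) *\<^sub>R a)"
          using st by (intro mvt_simple[OF st(1)] der) auto
        then obtain x where x: "s < x" "x < t"
          "\<phi> t - \<phi> s = frechet_derivative f (at (p + x *\<^sub>R a)) ((t - s) *\<^sub>R a)" by auto
        have dx: "\<kappa> < frechet_derivative f (at (p + x *\<^sub>R a)) a" "p + x *\<^sub>R a \<in> U"
          using r(2)[OF near(1)[of x]] x st by auto
        have "f differentiable (at (p + x *\<^sub>R a))" using f dx(2) by (auto simp: C2_on_def)
        hence "linear (frechet_derivative f (at (p + x *\<^sub>R a)))" by (rule linear_frechet_derivative)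
        hence "\<phi> t - \<phi> s = (t - s) * frechet_derivative f (at (p + x *\<^sub>R a)) a"
          unfolding x(3) by (simp add: linear_cmul)
        thus ?thesis using dx(1) st(1) by (simp add: mult.commute)
      qed
      have "\<phi> 0 = f p" by (simp add: \<phi>_def)
      hence "\<phi> (-\<rho>) \<le> 0" "0 \<le> \<phi> \<rho>"
        using incr[of "-\<rho>" 0] incr[of 0 \<rho>] \<rho>(1) elim(1) by auto
      moreover have "continuous_on {-\<rho>..\<rho>} \<phi>"
        unfolding continuous_on_eq_continuous_within by (auto intro!: has_derivative_continuous[OF der])
      ultimately obtain t where t: "-\<rho> \<le> t" "t \<le> \<rho>" "\<phi> t = 0"
        using IVT'[of \<phi> "-\<rho>" 0 \<rho>] \<rho>(1) by auto
      define q where "q = p + t *\<^sub>R a"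
      define s where "s = t * \<sigma>"
      have q: "q = p + s *\<^sub>R b" by (simp add: q_def a_def s_def)
      have s: "\<bar>s\<bar> \<le> \<rho>" using t \<sigma> by (auto simp: s_def)
      have qz: "dist q z < r" "dist q z < \<eta>" using near[of t] t by (auto simp: q_def)
      have "q \<in> Z" using r(2)[OF qz(1)] t(3) fZ by (auto simp: q_def \<phi>_def)
      hence qB: "q \<in> frontier B" using Z(3) by auto
      \<comment> \<open>Otherwise whichever of \<open>p\<close> and \<open>q\<close> is lower along
        \<open>b\<close> arises from the other by moving inward, and so is interior.\<close>
      have "s = 0"
      proof (rule ccontr)
        assume "s \<noteq> 0"
        then consider "s < 0" | "s > 0" by linarith
        thus False
        proof cases
          case 1
          have "p - (-s) *\<^sub>R b \<in> interior B"
            using 1 s \<rho> elim(2) pB fB \<eta>(1) by (intro inward) auto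
          thus False using qB q by (simp add: frontier_def)
        next
          case 2
          have "q - s *\<^sub>R b \<in> interior B" using 2 s \<rho> qz qB fB by (intro inward) auto
          thus False using pB q by (simp add: frontier_def)
        qed
      qed
      thus "p \<in> Z" using \<open>q \<in> Z\<close> q by simp
    qed
  qed
qed

section \<open>Perturbed linear recurrences\<close>

lemma ratio_decay:
  fixes w :: "nat \<Rightarrow> real"
  assumes mu: "0 < \<mu>" and step: "\<forall>\<^sub>F k in sequentially. w (Suc k) \<le> \<mu> * w k"
  obtains C where "C > 0" "\<forall>\<^sub>F k in sequentially. w k \<le> C * \<mu> ^ k"
proof -
  obtain K where K: "\<And>k. k \<ge> K \<Longrightarrow> w (Suc k) \<le> \<mu> * w k"
    using step by (auto simp: eventually_sequentially)
  have wk: "w (K + j) \<le> \<mu> ^ j * w K" for j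
  proof (induction j)
    case (Suc j)
    have "w (K + Suc j) \<le> \<mu> * w (K + j)" using K[of "K + j"] by simp
    also have "\<dots> \<le> \<mu> * (\<mu> ^ j * w K)" using Suc mu by (intro mult_left_mono) auto
    finally show ?case by (simp add: algebra_simps)
  qed simp
  show ?thesis
  proof (rule that)
    show "0 < \<bar>w K\<bar> / \<mu> ^ K + 1" using mu by (simp add: add_nonneg_pos)
    show "\<forall>\<^sub>F k in sequentially. w k \<le> (\<bar>w K\<bar> / \<mu> ^ K + 1) * \<mu> ^ k"
    proof (rule eventually_sequentiallyI[of K])
      fix k assume "K \<le> k"
      then obtain j where j: "k = K + j" using le_Suc_ex by blast
      have "w k \<le> \<mu> ^ j * w K" using wk by (simp add: j)
      also have "\<dots> \<le> \<mu> ^ j * \<bar>w K\<bar>" using mu by (intro mult_left_mono) auto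
      also have "\<dots> = \<bar>w K\<bar> / \<mu> ^ K * \<mu> ^ k" using mu by (simp add: j power_add)
      also have "\<dots> \<le> (\<bar>w K\<bar> / \<mu> ^ K + 1) * \<mu> ^ k" using mu by (intro mult_right_mono) auto
      finally show "w k \<le> (\<bar>w K\<bar> / \<mu> ^ K + 1) * \<mu> ^ k" .
    qed
  qed
qed

text \<open>With \<open>l1\<close>, \<open>l2\<close> the characteristic roots, \<open>u (Suc k) - l1 * u k\<close> is a perturbed geometric sequence of ratio
  \<open>l2\<close>; a large weight on it makes the sum with \<open>\<bar>u k\<bar> + \<bar>v k\<bar>\<close> contract by \<open>\<mu>\<close>.\<close>
lemma linear_recurrence_decay:
  fixes u v :: "nat \<Rightarrow> real" and l1 l2 :: complex
  assumes tr: "l1 + l2 = of_real (m11 + m22)" and det: "l1 * l2 = of_real (m11 * m22 - m12 * m21)"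
    and l: "cmod l1 \<le> g" "cmod l2 \<le> g" and g: "g < \<mu>"
    and u: "\<And>e. e > 0 \<Longrightarrow> \<forall>\<^sub>F k in sequentially. \<bar>u (Suc k) - (m11 * u k + m12 * v k)\<bar> \<le> e * (\<bar>u k\<bar> + \<bar>v k\<bar>)"
    and v: "\<And>e. e > 0 \<Longrightarrow> \<forall>\<^sub>F k in sequentially. \<bar>v (Suc k) - (m21 * u k + m22 * v k)\<bar> \<le> e * (\<bar>u k\<bar> + \<bar>v k\<bar>)"
  obtains C where "C > 0" "\<forall>\<^sub>F k in sequentially. \<bar>u k\<bar> + \<bar>v k\<bar> \<le> C * \<mu> ^ k"
proof -
  have g0: "0 \<le> g" using l(1) norm_ge_zero order_trans by blast
  have mu: "0 < \<mu>" using g0 g by simp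
  \<comment> \<open>The weight solving \<open>1 + R * g = \<mu> * R\<close>: the unweighted
    contribution of \<open>p\<close> and \<open>q\<close> to \<open>n\<close> uses up the gap
    between \<open>g\<close> and \<mu>.\<close>
  define R where "R = 1 / (\<mu> - g)"
  have R: "0 < R" using g by (simp add: R_def)
  define M where "M = 1 + \<bar>m11\<bar> + \<bar>m12\<bar> + \<bar>m21\<bar> + \<bar>m22\<bar>"
  have M: "1 \<le> M" by (simp add: M_def)
  define n where "n k = \<bar>u k\<bar> + \<bar>v k\<bar>" for k
  \<comment> \<open>Makes the weighted perturbation at most \<open>\<mu> - g\<close>. The factor 3M
    + 2 bounds the error in each of the two deflated sequences.\<close>
  define e where "e = min 1 ((\<mu> - g) / (R * (2 * (3 * M + 2))))"
  have e: "0 < e" "e \<le> 1" using g R M by (auto simp: e_def)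
  have "e \<le> (\<mu> - g) / (R * (2 * (3 * M + 2)))" by (simp add: e_def)
  hence eR: "R * (e * (2 * (3 * M + 2))) \<le> \<mu> - g"
    using R M mult_pos_pos[of R "2 * (3 * M + 2)"] by (simp add: pos_le_divide_eq algebra_simps)
  define p where "p k = complex_of_real (u (Suc k)) - l1 * of_real (u k)" for k
  define q where "q k = complex_of_real (v (Suc k)) - l1 * of_real (v k)" for k
  define W where "W k = n k + R * (cmod (p k) + cmod (q k))" for k
  obtain K where K: "\<And>k. k \<ge> K \<Longrightarrow> \<bar>u (Suc k) - (m11 * u k + m12 * v k)\<bar> \<le> e * n k"
                    "\<And>k. k \<ge> K \<Longrightarrow> \<bar>v (Suc k) - (m21 * u k + m22 * v k)\<bar> \<le> e * n k"
    using eventually_conj[OF u[OF e(1)] v[OF e(1)]]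
    unfolding eventually_sequentially n_def by blast
  have step: "W (Suc k) \<le> \<mu> * W k" if k: "k \<ge> K" for k
  proof -
    define r s where "r j = u (Suc j) - (m11 * u j + m12 * v j)" and
      "s j = v (Suc j) - (m21 * u j + m22 * v j)" for j
    have rs: "\<bar>r k\<bar> \<le> e * n k" "\<bar>s k\<bar> \<le> e * n k" "\<bar>r (Suc k)\<bar> \<le> e * n (Suc k)" "\<bar>s (Suc k)\<bar> \<le> e * n (Suc k)"
      using K[of k] K[of "Suc k"] k by (auto simp: r_def s_def)
    have n0: "0 \<le> n j" for j by (simp add: n_def)
    have m1: "\<bar>m11 * u k\<bar> \<le> \<bar>m11\<bar> * n k" "\<bar>m21 * u k\<bar> \<le> \<bar>m21\<bar> * n k"
       "\<bar>m12 * v k\<bar> \<le> \<bar>m12\<bar> * n k" "\<bar>m22 * v k\<bar> \<le> \<bar>m22\<bar> * n k"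
      by (auto simp: abs_mult n_def intro!: mult_left_mono)
    have e1: "e * n k \<le> n k" using e n0 by (simp add: mult_left_le_one_le)
    have "\<bar>u (Suc k)\<bar> \<le> \<bar>m11 * u k\<bar> + \<bar>m12 * v k\<bar> + \<bar>r k\<bar>"
      "\<bar>v (Suc k)\<bar> \<le> \<bar>m21 * u k\<bar> + \<bar>m22 * v k\<bar> + \<bar>s k\<bar>"
      by (simp_all add: r_def s_def)
    hence "n (Suc k) \<le> (\<bar>m11 * u k\<bar> + \<bar>m12 * v k\<bar> + \<bar>r k\<bar>) + (\<bar>m21 * u k\<bar> + \<bar>m22 * v k\<bar> + \<bar>s k\<bar>)"
      unfolding n_def by (rule add_mono)
    also have "\<dots> \<le> (\<bar>m11\<bar> * n k + \<bar>m12\<bar> * n k + n k) + (\<bar>m21\<bar> * n k + \<bar>m22\<bar> * n k + n k)"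
      by (intro add_mono m1 order_trans[OF rs(1) e1] order_trans[OF rs(2) e1])
    also have "\<dots> = M * n k + n k" by (simp add: M_def algebra_simps)
    finally have n1: "n (Suc k) \<le> (M + 1) * n k" by (simp add: algebra_simps)
    have en1: "e * n (Suc k) \<le> (M + 1) * (e * n k)"
      using mult_left_mono[OF n1, of e] e by (simp add: algebra_simps)
    have cs: "z - (l1 + l2) * w + l1 * l2 * t = (z - l1 * w) - l2 * (w - l1 * t)" for z w t
      by (simp add: algebra_simps)
    \<comment> \<open>Cayley-Hamilton: eliminating \<open>v\<close> leaves a second-order recurrence
      with trace and determinant as coefficients; \<open>cs\<close> factors it by the roots.\<close>
    have "u (Suc (Suc k)) - (m11 + m22) * u (Suc k) + (m11 * m22 - m12 * m21) * u k
        = r (Suc k) - m22 * r k + m12 * s k"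
      by (simp add: r_def s_def algebra_simps)
    hence "of_real (u (Suc (Suc k))) - (l1 + l2) * of_real (u (Suc k)) + l1 * l2 * of_real (u k)
        = complex_of_real (r (Suc k) - m22 * r k + m12 * s k)"
      unfolding tr det by (simp flip: of_real_mult of_real_diff of_real_add)
    hence "p (Suc k) - l2 * p k = complex_of_real (r (Suc k) - m22 * r k + m12 * s k)"
      unfolding cs p_def .
    hence "p (Suc k) = l2 * p k + complex_of_real (r (Suc k) - m22 * r k + m12 * s k)"
      by (simp add: algebra_simps)
    hence p1: "cmod (p (Suc k)) \<le> cmod l2 * cmod (p k) + \<bar>r (Suc k) - m22 * r k + m12 * s k\<bar>"
      by (metis norm_mult norm_of_real norm_triangle_ineq)
    have "v (Suc (Suc k)) - (m11 + m22) * v (Suc k) + (m11 * m22 - m12 * m21) * v k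
        = s (Suc k) - m11 * s k + m21 * r k"
      by (simp add: r_def s_def algebra_simps)
    hence "of_real (v (Suc (Suc k))) - (l1 + l2) * of_real (v (Suc k)) + l1 * l2 * of_real (v k)
        = complex_of_real (s (Suc k) - m11 * s k + m21 * r k)"
      unfolding tr det by (simp flip: of_real_mult of_real_diff of_real_add)
    hence "q (Suc k) - l2 * q k = complex_of_real (s (Suc k) - m11 * s k + m21 * r k)"
      unfolding cs q_def .
    hence "q (Suc k) = l2 * q k + complex_of_real (s (Suc k) - m11 * s k + m21 * r k)"
      by (simp add: algebra_simps)
    hence q1: "cmod (q (Suc k)) \<le> cmod l2 * cmod (q k) + \<bar>s (Suc k) - m11 * s k + m21 * r k\<bar>"
      by (metis norm_mult norm_of_real norm_triangle_ineq)
    have Mb: "\<bar>m11\<bar> \<le> M" "\<bar>m12\<bar> \<le> M" "\<bar>m21\<bar> \<le> M" "\<bar>m22\<bar> \<le> M" by (auto simp: M_def)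
    have m2: "\<bar>m * w\<bar> \<le> M * (e * n k)" if "\<bar>m\<bar> \<le> M" "\<bar>w\<bar> \<le> e * n k" for m w
      unfolding abs_mult using that M by (intro mult_mono) auto
    have "\<bar>r (Suc k) - m22 * r k + m12 * s k\<bar> \<le> \<bar>r (Suc k)\<bar> + \<bar>m22 * r k\<bar> + \<bar>m12 * s k\<bar>" by linarith
    also have "\<dots> \<le> (M + 1) * (e * n k) + M * (e * n k) + M * (e * n k)"
      using rs en1 m2[OF Mb(4) rs(1)] m2[OF Mb(2) rs(2)] by linarith
    finally have p2: "\<bar>r (Suc k) - m22 * r k + m12 * s k\<bar> \<le> (3 * M + 2) * (e * n k)"
      using mult_nonneg_nonneg[OF less_imp_le[OF e(1)] n0[of k]] by (simp add: algebra_simps)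
    have "\<bar>s (Suc k) - m11 * s k + m21 * r k\<bar> \<le> \<bar>s (Suc k)\<bar> + \<bar>m11 * s k\<bar> + \<bar>m21 * r k\<bar>" by linarith
    also have "\<dots> \<le> (M + 1) * (e * n k) + M * (e * n k) + M * (e * n k)"
      using rs en1 m2[OF Mb(1) rs(2)] m2[OF Mb(3) rs(1)] by linarith
    finally have q2: "\<bar>s (Suc k) - m11 * s k + m21 * r k\<bar> \<le> (3 * M + 2) * (e * n k)"
      using mult_nonneg_nonneg[OF less_imp_le[OF e(1)] n0[of k]] by (simp add: algebra_simps)
    have l2: "cmod l2 * cmod (p k) \<le> g * cmod (p k)" "cmod l2 * cmod (q k) \<le> g * cmod (q k)"
      using l by (auto intro: mult_right_mono)
    have pq: "cmod (p (Suc k)) + cmod (q (Suc k)) \<le> g * (cmod (p k) + cmod (q k)) + e * (2 * (3 * M + 2)) * n k"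
      using p1 q1 p2 q2 l2 by (simp add: algebra_simps)
    have "complex_of_real (u (Suc k)) = p k + l1 * of_real (u k)" by (simp add: p_def)
    hence "\<bar>u (Suc k)\<bar> \<le> cmod (p k) + cmod l1 * \<bar>u k\<bar>"
      by (metis norm_mult norm_of_real norm_triangle_ineq)
    moreover have "complex_of_real (v (Suc k)) = q k + l1 * of_real (v k)" by (simp add: q_def)
    hence "\<bar>v (Suc k)\<bar> \<le> cmod (q k) + cmod l1 * \<bar>v k\<bar>"
      by (metis norm_mult norm_of_real norm_triangle_ineq)
    moreover have "cmod l1 * \<bar>u k\<bar> \<le> g * \<bar>u k\<bar>" "cmod l1 * \<bar>v k\<bar> \<le> g * \<bar>v k\<bar>"
      using l by (auto intro: mult_right_mono)
    ultimately have nn: "n (Suc k) \<le> g * n k + (cmod (p k) + cmod (q k))"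
      by (simp add: n_def algebra_simps)
    have "W (Suc k) \<le> g * n k + (cmod (p k) + cmod (q k))
        + R * (g * (cmod (p k) + cmod (q k)) + e * (2 * (3 * M + 2)) * n k)"
      unfolding W_def by (intro add_mono nn mult_left_mono[OF pq]) (use R in simp)
    also have "\<dots> = g * n k + R * (e * (2 * (3 * M + 2))) * n k + (1 + R * g) * (cmod (p k) + cmod (q k))"
      by (simp add: algebra_simps)
    also have "1 + R * g = \<mu> * R" using g by (simp add: R_def field_simps)
    also have "g * n k + R * (e * (2 * (3 * M + 2))) * n k \<le> \<mu> * n k"
      using mult_right_mono[OF eR n0[of k]] by (simp add: algebra_simps)
    finally show ?thesis by (simp add: W_def algebra_simps)
  qed
  have nW: "n k \<le> W k" for k using R by (simp add: W_def)
  obtain C where C: "C > 0" "\<forall>\<^sub>F k in sequentially. W k \<le> C * \<mu> ^ k"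
    using ratio_decay[OF mu, of W] step by (auto simp: eventually_sequentially)
  from C(2) have "\<forall>\<^sub>F k in sequentially. \<bar>u k\<bar> + \<bar>v k\<bar> \<le> C * \<mu> ^ k"
    by eventually_elim (use nW in \<open>auto simp: n_def intro: order_trans\<close>)
  with C(1) show ?thesis using that by blast
qed

lemma geometric_steps_limit:
  fixes x :: "nat \<Rightarrow> 'a::real_normed_vector"
  assumes lim: "x \<longlonglongrightarrow> l" and mu: "0 < \<mu>" "\<mu> < 1"
    and step: "\<forall>\<^sub>F k in sequentially. norm (x (Suc k) - x k) \<le> C * \<mu> ^ k"
  obtains D where "D > 0" "\<And>k. norm (x k - l) \<le> D * \<mu> ^ k"
proof -
  obtain K where K: "\<And>k. k \<ge> K \<Longrightarrow> norm (x (Suc k) - x k) \<le> C * \<mu> ^ k"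
    using step by (auto simp: eventually_sequentially)
  \<comment> \<open>The sum of the geometric tail, chosen so that \<open>C * \<mu> ^ k\<close>
    telescopes as a difference of consecutive \<open>E * \<mu> ^ k\<close>.\<close>
  define E where "E = C / (1 - \<mu>)"
  have C0: "0 \<le> C" using order_trans[OF norm_ge_zero K[OF order_refl]] mu
    by (simp add: zero_le_mult_iff not_le power_le_zero_eq)
  have E0: "0 \<le> E" using C0 mu by (simp add: E_def)
  have EC: "C * t + E * (\<mu> * t) = E * t" for t
  proof -
    have "C * t = E * (1 - \<mu>) * t" using mu by (simp add: E_def)
    thus ?thesis by (simp add: algebra_simps)
  qed
  have tel: "norm (x (k + j) - x k) \<le> E * \<mu> ^ k - E * \<mu> ^ (k + j)" if "k \<ge> K" for k j
  proof (induction j)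
    case (Suc j)
    have "norm (x (k + Suc j) - x k) \<le> norm (x (Suc (k + j)) - x (k + j)) + norm (x (k + j) - x k)"
      by (metis add_Suc_right norm_triangle_sub diff_add_cancel add_diff_eq norm_triangle_ineq)
    also have "\<dots> \<le> C * \<mu> ^ (k + j) + (E * \<mu> ^ k - E * \<mu> ^ (k + j))"
      using Suc K[of "k + j"] that by simp
    also have "\<dots> = E * \<mu> ^ k - E * \<mu> ^ (k + Suc j)" using EC[of "\<mu> ^ (k + j)"] by simp
    finally show ?case .
  qed simp
  have big: "norm (x k - l) \<le> E * \<mu> ^ k" if "k \<ge> K" for k
  proof (rule Lim_norm_ubound)
    show "(\<lambda>j. x k - x (k + j)) \<longlonglongrightarrow> x k - l"
      using LIMSEQ_ignore_initial_segment[OF lim, of k] by (intro tendsto_intros) (simp add: add.commute)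
    show "\<forall>\<^sub>F j in sequentially. norm (x k - x (k + j)) \<le> E * \<mu> ^ k"
    proof (rule always_eventually, rule allI)
      fix j
      have "0 \<le> E * \<mu> ^ (k + j)" using E0 mu by simp
      with tel[OF that, of j] show "norm (x k - x (k + j)) \<le> E * \<mu> ^ k"
        by (simp add: norm_minus_commute)
    qed
  qed simp
  \<comment> \<open>The finite sum covers the indices before \<open>K\<close>; the summand 1 ensures
    positivity.\<close>
  define D where "D = E + 1 + (\<Sum>k<K. norm (x k - l) / \<mu> ^ k)"
  have S0: "0 \<le> (\<Sum>k<K. norm (x k - l) / \<mu> ^ k)" using mu by (intro sum_nonneg) auto
  show ?thesis
  proof (rule that)
    show "0 < D" using E0 S0 by (simp add: D_def)
    fix k
    show "norm (x k - l) \<le> D * \<mu> ^ k"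
    proof (cases "k \<ge> K")
      case True
      have "E * \<mu> ^ k \<le> D * \<mu> ^ k" using mu S0 by (intro mult_right_mono) (auto simp: D_def)
      with big[OF True] show ?thesis by simp
    next
      case False
      have "norm (x k - l) / \<mu> ^ k \<le> (\<Sum>k<K. norm (x k - l) / \<mu> ^ k)"
        using False mu by (intro member_le_sum) auto
      hence "norm (x k - l) / \<mu> ^ k \<le> D" using E0 by (simp add: D_def)
      thus ?thesis using mu by (simp add: field_simps)
    qed
  qed
qed

section \<open>Eigenvalues of relaxed projections onto two hyperplanes\<close>

lemma closest_point_hyperplane:
  fixes n :: "'a::euclidean_space"
  assumes "norm n = 1"
  shows "closest_point {v. n \<bullet> v = 0} w = w - (n \<bullet> w) *\<^sub>R n"
proof (rule closest_point_unique[symmetric])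
  have n: "n \<bullet> n = 1" using assms by (simp add: dot_square_norm)
  show "convex {v. n \<bullet> v = 0}" "closed {v. n \<bullet> v = 0}" by (rule convex_hyperplane closed_hyperplane)+
  show "w - (n \<bullet> w) *\<^sub>R n \<in> {v. n \<bullet> v = 0}" using n by (simp add: inner_diff_right)
  show "\<forall>y\<in>{v. n \<bullet> v = 0}. dist w (w - (n \<bullet> w) *\<^sub>R n) \<le> dist w y"
  proof
    fix y assume "y \<in> {v. n \<bullet> v = 0}"
    hence "n \<bullet> w = n \<bullet> (w - y)" by (simp add: inner_diff_right)
    also have "\<bar>\<dots>\<bar> \<le> norm (w - y)" using Cauchy_Schwarz_ineq2[of n "w - y"] assms by simp
    finally show "dist w (w - (n \<bullet> w) *\<^sub>R n) \<le> dist w y" using assms by (simp add: dist_norm)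
  qed
qed

lemma relproj_hyperplane:
  fixes n :: "'a::euclidean_space"
  assumes "norm n = 1"
  shows "relproj \<alpha> {v. n \<bullet> v = 0} w = w - (\<alpha> * (n \<bullet> w)) *\<^sub>R n"
  by (simp add: relproj_resid resid_def closest_point_hyperplane[OF assms])

lemma complex_quadratic_roots:
  fixes s p :: complex
  obtains l1 l2 where "l1 + l2 = s" "l1 * l2 = p"
proof (rule that)
  let ?q = "csqrt (s\<^sup>2 - 4 * p)"
  show "(s + ?q) / 2 + (s - ?q) / 2 = s" by (simp add: field_simps)
  have "(s + ?q) / 2 * ((s - ?q) / 2) = (s\<^sup>2 - ?q\<^sup>2) / 4"
    by (simp add: field_simps power2_eq_square)
  thus "(s + ?q) / 2 * ((s - ?q) / 2) = p" by simp
qed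

lemma gamma_rate_upper:
  assumes "finite (complex_eigenvalues f)" "l \<in> complex_eigenvalues f" "l \<noteq> 1"
  shows "cmod l \<le> gamma_rate f"
  unfolding gamma_rate_def using assms by (intro Max_ge) auto

lemma gamma_rate_nonneg:
  assumes "finite (complex_eigenvalues f)"
  shows "0 \<le> gamma_rate f"
  unfolding gamma_rate_def using assms by (intro Max_ge) auto

context
  fixes a b :: "'a::euclidean_space" and \<alpha>1 \<alpha>2 :: real
  assumes ab: "norm a = 1" "norm b = 1"
begin

text \<open>This is S_T once the tangent spaces are written as orthogonal complements of the normals
  \<open>a\<close> and \<open>b\<close>.\<close>

definition hyperplanes_relproj :: "'a \<Rightarrow> 'a" where
  "hyperplanes_relproj = relproj \<alpha>2 {v. a \<bullet> v = 0} \<circ> relproj \<alpha>1 {v. b \<bullet> v = 0}"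

lemma hyperplanes_relproj_eq:
  "hyperplanes_relproj u = u - (\<alpha>1 * (b \<bullet> u)) *\<^sub>R b - (\<alpha>2 * (a \<bullet> u - \<alpha>1 * (b \<bullet> u) * (a \<bullet> b))) *\<^sub>R a"
  by (simp add: hyperplanes_relproj_def relproj_hyperplane ab inner_diff_right)

text \<open>Pairing an eigenvector with \<open>a\<close> and \<open>b\<close> gives a homogeneous
  2x2 complex system whose determinant is the quadratic. If both components vanished, the vector
  would lie in both hyperplanes, where the map is the identity, forcing z = 1.\<close>

lemma hyperplanes_relproj_eigenvalue_char:
  assumes "z \<in> complex_eigenvalues hyperplanes_relproj" "z \<noteq> 1"
  shows "z\<^sup>2 - of_real (2 - \<alpha>1 - \<alpha>2 + \<alpha>1 * \<alpha>2 * (a \<bullet> b)\<^sup>2) * z + of_real ((1 - \<alpha>1) * (1 - \<alpha>2)) = 0"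
proof -
  have n: "a \<bullet> a = 1" "b \<bullet> b = 1" using ab by (simp_all add: dot_square_norm)
  define c where "c = a \<bullet> b"
  have ba: "b \<bullet> a = c" by (simp add: c_def inner_commute)
  obtain u w where uw: "u \<noteq> 0 \<or> w \<noteq> 0" "hyperplanes_relproj u = Re z *\<^sub>R u - Im z *\<^sub>R w"
      "hyperplanes_relproj w = Im z *\<^sub>R u + Re z *\<^sub>R w"
    using assms(1) by (auto simp: complex_eigenvalues_def)
  define A where "A = Complex (a \<bullet> u) (a \<bullet> w)"
  define B where "B = Complex (b \<bullet> u) (b \<bullet> w)"
  have "a \<bullet> hyperplanes_relproj v = (1 - \<alpha>2) * (a \<bullet> v) - (1 - \<alpha>2) * \<alpha>1 * c * (b \<bullet> v)" for v
    by (simp add: hyperplanes_relproj_eq inner_diff_right n flip: c_def) (simp add: algebra_simps)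
  from this[of u] this[of w]
  have eA: "(z - 1 + of_real \<alpha>2) * A = - of_real ((1 - \<alpha>2) * \<alpha>1 * c) * B"
    unfolding uw by (auto simp: complex_eq_iff A_def B_def inner_diff_right inner_add_right algebra_simps)
  have "b \<bullet> hyperplanes_relproj v = (1 - \<alpha>1 + \<alpha>1 * \<alpha>2 * c\<^sup>2) * (b \<bullet> v) - \<alpha>2 * c * (a \<bullet> v)" for v
    by (simp add: hyperplanes_relproj_eq inner_diff_right n ba flip: c_def) (simp add: algebra_simps power2_eq_square)
  from this[of u] this[of w]
  have eB: "(z - 1 + of_real (\<alpha>1 - \<alpha>1 * \<alpha>2 * c\<^sup>2)) * B = - of_real (\<alpha>2 * c) * A"
    unfolding uw by (auto simp: complex_eq_iff A_def B_def inner_diff_right inner_add_right algebra_simps)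
  define X where "X = z\<^sup>2 - of_real (2 - \<alpha>1 - \<alpha>2 + \<alpha>1 * \<alpha>2 * c\<^sup>2) * z + of_real ((1 - \<alpha>1) * (1 - \<alpha>2))"
  have X: "X = (z - 1 + of_real (\<alpha>1 - \<alpha>1 * \<alpha>2 * c\<^sup>2)) * (z - 1 + of_real \<alpha>2)
      - of_real ((1 - \<alpha>2) * \<alpha>1 * c) * of_real (\<alpha>2 * c)"
    by (simp add: X_def algebra_simps power2_eq_square)
  define p q r t where "p = z - 1 + complex_of_real (\<alpha>1 - \<alpha>1 * \<alpha>2 * c\<^sup>2)" and
    "q = z - 1 + complex_of_real \<alpha>2" and "r = complex_of_real ((1 - \<alpha>2) * \<alpha>1 * c)" and "t = complex_of_real (\<alpha>2 * c)"
  have X: "X = p * q - r * t" unfolding X p_def q_def r_def t_def by (rule refl)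
  have eA: "q * A = - r * B" and eB: "p * B = - t * A"
    using eA eB by (simp_all only: p_def q_def r_def t_def)
  have "X * A = p * (q * A) - r * t * A" unfolding X by (simp add: algebra_simps)
  also have "\<dots> = - r * (p * B) - r * t * A" unfolding eA by (simp add: algebra_simps)
  also have "\<dots> = 0" unfolding eB by (simp add: algebra_simps)
  finally have XA: "X * A = 0" .
  have "X * B = q * (p * B) - r * t * B" unfolding X by (simp add: algebra_simps)
  also have "\<dots> = - t * (q * A) - r * t * B" unfolding eB by (simp add: algebra_simps)
  also have "\<dots> = 0" unfolding eA by (simp add: algebra_simps)
  finally have XB: "X * B = 0" .
  have "A \<noteq> 0 \<or> B \<noteq> 0"
  proof (rule ccontr)
    assume "\<not> ?thesis"
    hence "a \<bullet> u = 0" "a \<bullet> w = 0" "b \<bullet> u = 0" "b \<bullet> w = 0" by (auto simp: A_def B_def complex_eq_iff)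
    hence e: "u = Re z *\<^sub>R u - Im z *\<^sub>R w" "w = Im z *\<^sub>R u + Re z *\<^sub>R w"
      using uw(2,3) by (auto simp: hyperplanes_relproj_eq)
    define m where "m = Re z - 1"
    have m: "m *\<^sub>R u = Im z *\<^sub>R w" "m *\<^sub>R w = - (Im z *\<^sub>R u)"
      using e by (auto simp: m_def algebra_simps)
    have "(m * m + Im z * Im z) *\<^sub>R u = m *\<^sub>R (m *\<^sub>R u) + Im z *\<^sub>R (Im z *\<^sub>R u)" by (simp add: algebra_simps)
    also have "\<dots> = Im z *\<^sub>R (m *\<^sub>R w + Im z *\<^sub>R u)" unfolding m(1) by (simp add: algebra_simps)
    also have "\<dots> = 0" unfolding m(2) by simp
    finally have 1: "(m * m + Im z * Im z) *\<^sub>R u = 0" .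
    have "(m * m + Im z * Im z) *\<^sub>R w = m *\<^sub>R (m *\<^sub>R w) + Im z *\<^sub>R (Im z *\<^sub>R w)" by (simp add: algebra_simps)
    also have "\<dots> = - (Im z *\<^sub>R (m *\<^sub>R u - Im z *\<^sub>R w))" unfolding m(2) by (simp add: algebra_simps)
    also have "\<dots> = 0" unfolding m(1) by simp
    finally have 2: "(m * m + Im z * Im z) *\<^sub>R w = 0" .
    have "m * m + Im z * Im z = 0" using 1 2 uw(1) by auto
    hence "z = 1" by (simp add: sum_squares_eq_zero_iff m_def complex_eq_iff)
    with assms(2) show False by simp
  qed
  with XA XB have "X = 0" by auto
  thus ?thesis by (simp add: X_def c_def)
qed

text \<open>Finiteness gives the \<open>Max\<close> in \<open>gamma_rate\<close> its meaning; apart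
  from 1 there are only the two roots of the quadratic.\<close>

lemma hyperplanes_relproj_eigenvalues_finite: "finite (complex_eigenvalues hyperplanes_relproj)"
proof -
  obtain l1 l2 where l: "l1 + l2 = complex_of_real (2 - \<alpha>1 - \<alpha>2 + \<alpha>1 * \<alpha>2 * (a \<bullet> b)\<^sup>2)"
    "l1 * l2 = of_real ((1 - \<alpha>1) * (1 - \<alpha>2))" using complex_quadratic_roots .
  have "z \<in> {1, l1, l2}" if "z \<in> complex_eigenvalues hyperplanes_relproj" for z
  proof (cases "z = 1")
    case False
    have "(z - l1) * (z - l2) = z\<^sup>2 - (l1 + l2) * z + l1 * l2"
      by (simp add: algebra_simps power2_eq_square)
    also have "\<dots> = 0" unfolding l by (rule hyperplanes_relproj_eigenvalue_char[OF that False])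
    finally show ?thesis by auto
  qed simp
  thus ?thesis by (meson finite.emptyI finite.insertI finite_subset subsetI)
qed

text \<open>The eigenvector is \<open>(1 - \<alpha>1 - z) a + \<alpha>1 (a \<bullet> b) b\<close>: its \<open>b\<close>-component solves the eigenvalue equation
  identically in \<open>z\<close>, its \<open>a\<close>-component is the characteristic equation.\<close>
lemma hyperplanes_relproj_root_eigenvalue:
  assumes z: "z\<^sup>2 - of_real (2 - \<alpha>1 - \<alpha>2 + \<alpha>1 * \<alpha>2 * (a \<bullet> b)\<^sup>2) * z + of_real ((1 - \<alpha>1) * (1 - \<alpha>2)) = 0"
    and c: "a \<bullet> b \<noteq> 0" "\<bar>a \<bullet> b\<bar> < 1" and \<alpha>: "\<alpha>1 \<noteq> 0" "\<alpha>2 \<noteq> 0"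
  shows "z \<in> complex_eigenvalues hyperplanes_relproj" "z \<noteq> 1"
proof -
  have n: "a \<bullet> a = 1" "b \<bullet> b = 1" using ab by (simp_all add: dot_square_norm)
  define c where "c = a \<bullet> b"
  have ba: "b \<bullet> a = c" by (simp add: c_def inner_commute)
  have c2: "c\<^sup>2 < 1" using c(2) by (simp add: c_def abs_square_less_1)
  define x where "x = Re z" define y where "y = Im z"
  have zxy: "z = Complex x y" by (simp add: x_def y_def)
  have re: "x\<^sup>2 - y\<^sup>2 - (2 - \<alpha>1 - \<alpha>2 + \<alpha>1 * \<alpha>2 * c\<^sup>2) * x + (1 - \<alpha>1) * (1 - \<alpha>2) = 0"
    and im: "2 * x * y - (2 - \<alpha>1 - \<alpha>2 + \<alpha>1 * \<alpha>2 * c\<^sup>2) * y = 0"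
    using z unfolding zxy by (auto simp: complex_eq_iff power2_eq_square c_def)
  \<comment> \<open>\<open>u\<close> and \<open>w\<close> are the real and imaginary parts of the
    complex eigenvector.\<close>
  define u where "u = (1 - \<alpha>1 - x) *\<^sub>R a + (\<alpha>1 * c) *\<^sub>R b"
  define w where "w = (- y) *\<^sub>R a"
  have L: "hyperplanes_relproj (p *\<^sub>R a + q *\<^sub>R b) = (p - \<alpha>2 * (p + q * c - \<alpha>1 * (p * c + q) * c)) *\<^sub>R a
      + (q - \<alpha>1 * (p * c + q)) *\<^sub>R b" for p q
    unfolding hyperplanes_relproj_eq by (simp add: inner_add_right n ba flip: c_def) (simp add: algebra_simps)
  have "u \<noteq> 0"
  proof
    assume "u = 0"
    hence "(1 - \<alpha>1 - x) *\<^sub>R a = (- (\<alpha>1 * c)) *\<^sub>R b" by (simp add: u_def eq_neg_iff_add_eq_0)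
    hence "a \<bullet> ((1 - \<alpha>1 - x) *\<^sub>R a) = a \<bullet> ((- (\<alpha>1 * c)) *\<^sub>R b)"
      "b \<bullet> ((1 - \<alpha>1 - x) *\<^sub>R a) = b \<bullet> ((- (\<alpha>1 * c)) *\<^sub>R b)" by simp_all
    hence e: "1 - \<alpha>1 - x = - (\<alpha>1 * c\<^sup>2)" "(1 - \<alpha>1 - x) * c = - (\<alpha>1 * c)"
      by (simp_all add: n ba power2_eq_square flip: c_def)
    hence "\<alpha>1 * c * (1 - c\<^sup>2) = 0" unfolding e(1) by (simp add: algebra_simps)
    thus False using c(1) c2 \<alpha> by (simp add: c_def)
  qed
  moreover have "hyperplanes_relproj u = x *\<^sub>R u - y *\<^sub>R w"
  proof -
    have 1: "\<alpha>1 * c - \<alpha>1 * ((1 - \<alpha>1 - x) * c + \<alpha>1 * c) = x * (\<alpha>1 * c)" by (simp add: algebra_simps)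
    have 2: "(1 - \<alpha>1 - x) - \<alpha>2 * ((1 - \<alpha>1 - x) + \<alpha>1 * c * c - \<alpha>1 * ((1 - \<alpha>1 - x) * c + \<alpha>1 * c) * c)
        = x * (1 - \<alpha>1 - x) + y * y"
      using re by (simp add: algebra_simps power2_eq_square)
    show ?thesis unfolding u_def w_def L 1 2 by (simp add: algebra_simps)
  qed
  moreover have "hyperplanes_relproj w = y *\<^sub>R u + x *\<^sub>R w"
  proof -
    have w: "w = (- y) *\<^sub>R a + 0 *\<^sub>R b" by (simp add: w_def)
    have 1: "0 - \<alpha>1 * (- y * c + 0) = y * (\<alpha>1 * c)" by simp
    have 2: "(- y) - \<alpha>2 * ((- y) + 0 * c - \<alpha>1 * ((- y) * c + 0) * c) = y * (1 - \<alpha>1 - x) + x * (- y)"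
      using im by (simp add: algebra_simps power2_eq_square)
    show ?thesis unfolding u_def by (subst w, subst L, unfold 1 2, subst w)
      (simp add: algebra_simps flip: scaleR_add_left)
  qed
  ultimately show "z \<in> complex_eigenvalues hyperplanes_relproj"
    unfolding complex_eigenvalues_def x_def y_def by blast
  show "z \<noteq> 1"
  proof
    assume "z = 1"
    hence "x = 1" "y = 0" by (simp_all add: x_def y_def)
    hence "\<alpha>1 * \<alpha>2 * (1 - c\<^sup>2) = 0" using re by (simp add: algebra_simps)
    thus False using \<alpha> c2 by simp
  qed
qed

text \<open>The hyperplanes coincide and each relaxation multiplies \<open>b\<close> by 1 -
  \<alpha>1 or 1 - \<alpha>2. The product is 1 precisely when \<alpha>1 + \<alpha>2 = \<alpha>1
  \<alpha>2.\<close>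

lemma hyperplanes_relproj_opposite_eigenvalue:
  assumes "a = - b" and \<alpha>: "\<alpha>1 + \<alpha>2 \<noteq> \<alpha>1 * \<alpha>2"
  shows "of_real ((1 - \<alpha>1) * (1 - \<alpha>2)) \<in> complex_eigenvalues hyperplanes_relproj"
    "complex_of_real ((1 - \<alpha>1) * (1 - \<alpha>2)) \<noteq> 1"
proof -
  have n: "b \<bullet> b = 1" using ab by (simp add: dot_square_norm)
  have "hyperplanes_relproj b = ((1 - \<alpha>1) * (1 - \<alpha>2)) *\<^sub>R b"
    unfolding hyperplanes_relproj_eq by (simp add: n assms(1)) (simp add: algebra_simps)
  moreover have "hyperplanes_relproj 0 = 0" by (simp add: hyperplanes_relproj_eq)
  moreover have "b \<noteq> 0" using ab by auto
  ultimately show "of_real ((1 - \<alpha>1) * (1 - \<alpha>2)) \<in> complex_eigenvalues hyperplanes_relproj"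
    unfolding complex_eigenvalues_def mem_Collect_eq by (intro exI[of _ b] exI[of _ 0]) simp
  show "complex_of_real ((1 - \<alpha>1) * (1 - \<alpha>2)) \<noteq> 1"
    unfolding of_real_eq_1_iff using \<alpha> by (simp add: algebra_simps)
qed

end

section \<open>The local rate\<close>

text \<open>The subgradient inequality at \<open>w k\<close> and at \<open>w' k\<close> encloses the
  change of distance between two inner products with the step, and both directions are within
  \<open>e\<close> of \<open>n\<close>.\<close>

lemma resid_difference_near_smooth_point:
  fixes C :: "'a::euclidean_space set"
  assumes C: "closed C" "convex C" and z: "smooth_boundary_point C z n"
    and w: "w \<longlonglongrightarrow> z" "\<forall>\<^sub>F k in sequentially. w k \<notin> C"
    and w': "w' \<longlonglongrightarrow> z" "\<forall>\<^sub>F k in sequentially. w' k \<notin> C" and e: "0 < e"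
  shows "\<forall>\<^sub>F k in sequentially.
    \<bar>norm (resid C (w' k)) - norm (resid C (w k)) - n \<bullet> (w' k - w k)\<bar> \<le> e * norm (w' k - w k)"
proof -
  have ne: "C \<noteq> {}" using z by (auto simp: smooth_boundary_point_def)
  have near: "\<forall>\<^sub>F k in sequentially. v k \<notin> C \<longrightarrow> norm (sgn (resid C (v k)) - n) < e" if "v \<longlonglongrightarrow> z" for v
    using resid_direction_near_smooth_point[OF C z e] that by (rule eventually_compose_filterlim)
  show ?thesis
    using w(2) w'(2) near[OF w(1)] near[OF w'(1)]
  proof eventually_elim
    case (elim k)
    let ?d = "w' k - w k" and ?m = "sgn (resid C (w k))" and ?m' = "sgn (resid C (w' k))"
    have "?m \<bullet> ?d \<le> norm (resid C (w' k)) - norm (resid C (w k))"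
      by (rule resid_distance_subgradient[OF C ne])
    moreover have "norm (resid C (w' k)) - norm (resid C (w k)) \<le> ?m' \<bullet> ?d"
      using resid_distance_subgradient[OF C ne, of "w' k" "w k"] by (simp add: inner_diff_right)
    moreover have "\<bar>(?m - n) \<bullet> ?d\<bar> \<le> e * norm ?d"
      using elim by (intro order_trans[OF Cauchy_Schwarz_ineq2] mult_right_mono) auto
    moreover have "\<bar>(?m' - n) \<bullet> ?d\<bar> \<le> e * norm ?d"
      using elim by (intro order_trans[OF Cauchy_Schwarz_ineq2] mult_right_mono) auto
    ultimately show ?case by (simp add: inner_diff_left)
  qed
qed

lemma inner_resid_near_smooth_point:
  fixes C :: "'a::euclidean_space set"
  assumes C: "closed C" "convex C" and z: "smooth_boundary_point C z n"
    and w: "w \<longlonglongrightarrow> z" "\<forall>\<^sub>F k in sequentially. w k \<notin> C" and b: "norm b = 1" and e: "0 < e"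
  shows "\<forall>\<^sub>F k in sequentially.
    \<bar>b \<bullet> resid C (w k) - (b \<bullet> n) * norm (resid C (w k))\<bar> \<le> e * norm (resid C (w k))"
proof -
  have "\<forall>\<^sub>F k in sequentially. w k \<notin> C \<longrightarrow> norm (sgn (resid C (w k)) - n) < e"
    using resid_direction_near_smooth_point[OF C z e] w(1) by (rule eventually_compose_filterlim)
  with w(2) show ?thesis
  proof eventually_elim
    case (elim k)
    let ?r = "resid C (w k)"
    have br: "b \<bullet> ?r = norm ?r * (b \<bullet> sgn ?r)" by (cases "?r = 0") (simp_all add: sgn_div_norm)
    have "b \<bullet> ?r - (b \<bullet> n) * norm ?r = norm ?r * (b \<bullet> (sgn ?r - n))"
      unfolding inner_diff_right right_diff_distrib br by simp
    also have "\<bar>\<dots>\<bar> \<le> norm ?r * norm (sgn ?r - n)"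
      unfolding abs_mult using Cauchy_Schwarz_ineq2[of b "sgn ?r - n"] b by (intro mult_mono) auto
    also have "\<dots> \<le> e * norm ?r" using elim by (subst mult.commute) (intro mult_right_mono, auto)
    finally show ?case .
  qed
qed

text \<open>The nearest point in \<open>C\<close> already lies on the boundary, and a closed set
  contains its boundary, so no boundary point is nearer.\<close>

lemma relproj_in_relproj_set_frontier:
  fixes C :: "'a::euclidean_space set"
  assumes C: "closed C" "convex C" "C \<noteq> {}" and w: "w \<notin> C"
  shows "relproj \<alpha> C w \<in> relproj_set \<alpha> (frontier C) w"
proof -
  let ?p = "closest_point C w"
  have "?p \<in> frontier C" by (rule closest_point_in_frontier[OF C w])
  moreover have "dist w ?p \<le> dist w y" if "y \<in> frontier C" for y
    using closest_point_le[OF C(1)] that C(1) frontier_subset_closed by blast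
  ultimately show ?thesis by (auto simp: relproj_set_def nearest_points_def relproj_def)
qed

text \<open>The tail of an iteration that never solves the problem: both projections act from
  outside, near a point where each set has one normal.\<close>

locale alternating_relproj =
  fixes A B :: "'a::euclidean_space set" and x :: "nat \<Rightarrow> 'a" and \<alpha>1 \<alpha>2 :: real and z a b :: 'a
  assumes A: "closed A" "convex A" "interior A \<noteq> {}" and B: "closed B" "convex B" "interior B \<noteq> {}"
    and \<alpha>: "1 < \<alpha>1" "\<alpha>1 < 2" "1 < \<alpha>2" "\<alpha>2 < 2"
    and iter: "\<And>k. x (Suc k) = relproj \<alpha>2 A (relproj \<alpha>1 B (x k))"
    and a: "smooth_boundary_point A z a" and b: "smooth_boundary_point B z b"
    and lim: "x \<longlonglongrightarrow> z" "(\<lambda>k. relproj \<alpha>1 B (x k)) \<longlonglongrightarrow> z"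
    and out: "\<forall>\<^sub>F k in sequentially. x k \<notin> B" "\<forall>\<^sub>F k in sequentially. relproj \<alpha>1 B (x k) \<notin> A"
begin

definition "y k = relproj \<alpha>1 B (x k)"
definition "d k = norm (resid B (x k))"
definition "e k = norm (resid A (y k))"
abbreviation "c \<equiv> a \<bullet> b"

lemma unit: "norm a = 1" "norm b = 1" "a \<bullet> a = 1" "b \<bullet> b = 1"
  using a b by (auto simp: smooth_boundary_point_def unit_normal_def dot_square_norm)

lemma c_bound: "\<bar>c\<bar> \<le> 1"
  using Cauchy_Schwarz_ineq2[of a b] unit by simp

lemma nonneg: "0 \<le> d k" "0 \<le> e k"
  by (auto simp: d_def e_def)

lemma nonempty: "A \<noteq> {}" "B \<noteq> {}"
  using a b by (auto simp: smooth_boundary_point_def)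

lemma ylim: "y \<longlonglongrightarrow> z"
  using lim(2) by (simp add: y_def[abs_def])

lemma yout: "\<forall>\<^sub>F k in sequentially. y k \<notin> A"
  using out(2) by (simp add: y_def)

lemma x_Suc: "x (Suc k) - x k = - (\<alpha>1 *\<^sub>R resid B (x k)) - \<alpha>2 *\<^sub>R resid A (y k)"
  by (simp add: iter y_def relproj_resid)

lemma y_Suc: "y (Suc k) - y k = - (\<alpha>2 *\<^sub>R resid A (y k)) - \<alpha>1 *\<^sub>R resid B (x (Suc k))"
proof -
  have "y (Suc k) = x (Suc k) - \<alpha>1 *\<^sub>R resid B (x (Suc k))" by (simp add: y_def relproj_resid)
  moreover have "x (Suc k) = y k - \<alpha>2 *\<^sub>R resid A (y k)" by (simp add: iter flip: y_def) (simp add: relproj_resid)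
  ultimately show ?thesis by simp
qed

lemma norm_x_step: "norm (x (Suc k) - x k) \<le> 2 * (d k + e k)"
proof -
  have "norm (x (Suc k) - x k) \<le> \<alpha>1 * d k + \<alpha>2 * e k"
    unfolding x_Suc using \<alpha> by (intro order_trans[OF norm_triangle_ineq4]) (simp add: d_def e_def)
  also have "\<dots> \<le> 2 * d k + 2 * e k" using \<alpha> nonneg by (intro add_mono mult_right_mono) auto
  finally show ?thesis by simp
qed

lemma norm_y_step: "norm (y (Suc k) - y k) \<le> 2 * (e k + d (Suc k))"
proof -
  have "norm (y (Suc k) - y k) \<le> \<alpha>2 * e k + \<alpha>1 * d (Suc k)"
    unfolding y_Suc using \<alpha> by (intro order_trans[OF norm_triangle_ineq4]) (simp add: d_def e_def)
  also have "\<dots> \<le> 2 * e k + 2 * d (Suc k)" using \<alpha> nonneg by (intro add_mono mult_right_mono) auto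
  finally show ?thesis by simp
qed

lemma d_recurrence:
  assumes "0 < \<epsilon>"
  shows "\<forall>\<^sub>F k in sequentially. \<bar>d (Suc k) - ((1 - \<alpha>1) * d k - \<alpha>2 * c * e k)\<bar> \<le> \<epsilon> * (d k + e k)"
proof -
  \<comment> \<open>The step length contributes 2\<delta> (d + e) and the two residual directions
    contribute 2\<delta> d and 2\<delta> e.\<close>
  define \<delta> where "\<delta> = \<epsilon> / 4"
  have \<delta>: "0 < \<delta>" using assms by (simp add: \<delta>_def)
  have xS: "(\<lambda>k. x (Suc k)) \<longlonglongrightarrow> z" using lim(1) by (rule LIMSEQ_Suc)
  have oS: "\<forall>\<^sub>F k in sequentially. x (Suc k) \<notin> B"
    using eventually_sequentially_Suc[of "\<lambda>k. x k \<notin> B"] out(1) by simp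
  from resid_difference_near_smooth_point[OF B(1,2) b lim(1) out(1) xS oS \<delta>]
    inner_resid_near_smooth_point[OF B(1,2) b lim(1) out(1) unit(2) \<delta>]
    inner_resid_near_smooth_point[OF A(1,2) a ylim yout unit(2) \<delta>]
  show ?thesis
  proof eventually_elim
    case (elim k)
    have 1: "\<bar>d (Suc k) - d k - b \<bullet> (x (Suc k) - x k)\<bar> \<le> 2 * \<delta> * (d k + e k)"
    proof -
      note elim(1)[folded d_def]
      also have "\<delta> * norm (x (Suc k) - x k) \<le> \<delta> * (2 * (d k + e k))"
        using norm_x_step \<delta> by (intro mult_left_mono) auto
      finally show ?thesis by (simp only: mult.assoc mult.left_commute)
    qed
    have 2: "b \<bullet> (x (Suc k) - x k) = - (\<alpha>1 * (b \<bullet> resid B (x k))) - \<alpha>2 * (b \<bullet> resid A (y k))"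
      by (simp add: x_Suc inner_diff_right)
    have 3: "\<bar>\<alpha>1 * (b \<bullet> resid B (x k)) - \<alpha>1 * d k\<bar> \<le> 2 * (\<delta> * d k)"
    proof -
      have "\<bar>\<alpha>1 * (b \<bullet> resid B (x k) - d k)\<bar> \<le> 2 * (\<delta> * d k)"
        unfolding abs_mult using elim(2) \<alpha> unit(4) by (intro mult_mono) (auto simp: d_def)
      thus ?thesis by (simp add: algebra_simps)
    qed
    have 4: "\<bar>\<alpha>2 * (b \<bullet> resid A (y k)) - \<alpha>2 * c * e k\<bar> \<le> 2 * (\<delta> * e k)"
    proof -
      have "\<bar>\<alpha>2 * (b \<bullet> resid A (y k) - c * e k)\<bar> \<le> 2 * (\<delta> * e k)"
        unfolding abs_mult using elim(3) \<alpha> by (intro mult_mono) (auto simp: e_def inner_commute[of b a])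
      thus ?thesis by (simp add: algebra_simps)
    qed
    have "\<epsilon> * (d k + e k) = 2 * \<delta> * (d k + e k) + 2 * (\<delta> * d k) + 2 * (\<delta> * e k)"
      by (simp add: \<delta>_def algebra_simps)
    moreover have "(1 - \<alpha>1) * d k = d k - \<alpha>1 * d k" by (simp add: algebra_simps)
    ultimately show ?case using 1 2 3 4 by linarith
  qed
qed

lemma e_recurrence_aux:
  assumes "0 < \<epsilon>"
  shows "\<forall>\<^sub>F k in sequentially. \<bar>e (Suc k) - ((1 - \<alpha>2) * e k - \<alpha>1 * c * d (Suc k))\<bar> \<le> \<epsilon> * (d k + e k)"
proof -
  \<comment> \<open>28 is 4 times 7: the error is 4\<delta> (e_k + d_{k+1}), and that sum is at most
    7 (d_k + e_k).\<close>
  define \<delta> where "\<delta> = \<epsilon> / 28"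
  have \<delta>: "0 < \<delta>" using assms by (simp add: \<delta>_def)
  have xS: "(\<lambda>k. x (Suc k)) \<longlonglongrightarrow> z" using lim(1) by (rule LIMSEQ_Suc)
  have oS: "\<forall>\<^sub>F k in sequentially. x (Suc k) \<notin> B"
    using eventually_sequentially_Suc[of "\<lambda>k. x k \<notin> B"] out(1) by simp
  have yS: "(\<lambda>k. y (Suc k)) \<longlonglongrightarrow> z" using ylim by (rule LIMSEQ_Suc)
  have yoS: "\<forall>\<^sub>F k in sequentially. y (Suc k) \<notin> A"
    using eventually_sequentially_Suc[of "\<lambda>k. y k \<notin> A"] yout by simp
  from resid_difference_near_smooth_point[OF A(1,2) a ylim yout yS yoS \<delta>]
    inner_resid_near_smooth_point[OF A(1,2) a ylim yout unit(1) \<delta>]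
    inner_resid_near_smooth_point[OF B(1,2) b xS oS unit(1) \<delta>]
    d_recurrence[of 1, simplified]
  show ?thesis
  proof eventually_elim
    case (elim k)
    have 1: "\<bar>e (Suc k) - e k - a \<bullet> (y (Suc k) - y k)\<bar> \<le> 2 * \<delta> * (e k + d (Suc k))"
    proof -
      note elim(1)[folded e_def]
      also have "\<delta> * norm (y (Suc k) - y k) \<le> \<delta> * (2 * (e k + d (Suc k)))"
        using norm_y_step \<delta> by (intro mult_left_mono) auto
      finally show ?thesis by (simp only: mult.assoc mult.left_commute)
    qed
    have 2: "a \<bullet> (y (Suc k) - y k) = - (\<alpha>2 * (a \<bullet> resid A (y k))) - \<alpha>1 * (a \<bullet> resid B (x (Suc k)))"
      by (simp add: y_Suc inner_diff_right)
    have 3: "\<bar>\<alpha>2 * (a \<bullet> resid A (y k)) - \<alpha>2 * e k\<bar> \<le> 2 * (\<delta> * e k)"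
    proof -
      have "\<bar>\<alpha>2 * (a \<bullet> resid A (y k) - e k)\<bar> \<le> 2 * (\<delta> * e k)"
        unfolding abs_mult using elim(2) \<alpha> unit(3) by (intro mult_mono) (auto simp: e_def)
      thus ?thesis by (simp add: algebra_simps)
    qed
    have 4: "\<bar>\<alpha>1 * (a \<bullet> resid B (x (Suc k))) - \<alpha>1 * c * d (Suc k)\<bar> \<le> 2 * (\<delta> * d (Suc k))"
    proof -
      have "\<bar>\<alpha>1 * (a \<bullet> resid B (x (Suc k)) - c * d (Suc k))\<bar> \<le> 2 * (\<delta> * d (Suc k))"
        unfolding abs_mult using elim(3) \<alpha> by (intro mult_mono) (auto simp: d_def)
      thus ?thesis by (simp add: algebra_simps)
    qed
    have "(1 - \<alpha>1) * d k \<le> 0" using \<alpha> nonneg by (simp add: mult_nonpos_nonneg)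
    moreover have "- (\<alpha>2 * c * e k) \<le> 2 * e k"
    proof -
      have "\<bar>\<alpha>2 * c\<bar> \<le> 2 * 1" unfolding abs_mult using \<alpha> c_bound by (intro mult_mono) auto
      hence "\<bar>\<alpha>2 * c\<bar> * e k \<le> 2 * e k" using nonneg by (intro mult_right_mono) auto
      moreover have "- (\<alpha>2 * c * e k) \<le> \<bar>\<alpha>2 * c\<bar> * e k"
        using abs_ge_minus_self[of "\<alpha>2 * c * e k"] nonneg(2)[of k] by (simp only: abs_mult abs_of_nonneg)
      ultimately show ?thesis by linarith
    qed
    ultimately have "e k + d (Suc k) \<le> 7 * (d k + e k)"
      using elim(4) nonneg[of k] by (simp add: abs_le_iff)
    from mult_left_mono[OF this, of "4 * \<delta>"] \<delta>
    have 5: "4 * \<delta> * (e k + d (Suc k)) \<le> \<epsilon> * (d k + e k)" by (simp add: \<delta>_def)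
    have "4 * \<delta> * (e k + d (Suc k)) = 2 * \<delta> * (e k + d (Suc k)) + 2 * (\<delta> * e k) + 2 * (\<delta> * d (Suc k))"
      by (simp add: algebra_simps)
    moreover have "(1 - \<alpha>2) * e k = e k - \<alpha>2 * e k" by (simp add: algebra_simps)
    ultimately show ?case using 1 2 3 4 5 by linarith
  qed
qed

text \<open>Substituting for \<open>d (Suc k)\<close> puts the system in matrix form at one index.
  The substituted error is amplified by at most 2, hence the thirds of \<epsilon>.\<close>

lemma e_recurrence:
  assumes "0 < \<epsilon>"
  shows "\<forall>\<^sub>F k in sequentially.
    \<bar>e (Suc k) - (- (\<alpha>1 * c * (1 - \<alpha>1)) * d k + (1 - \<alpha>2 + \<alpha>1 * \<alpha>2 * c\<^sup>2) * e k)\<bar> \<le> \<epsilon> * (d k + e k)"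
proof -
  have "0 < \<epsilon> / 3" using assms by simp
  from d_recurrence[OF this] e_recurrence_aux[OF this] show ?thesis
  proof eventually_elim
    case (elim k)
    define s where "s = d (Suc k) - ((1 - \<alpha>1) * d k - \<alpha>2 * c * e k)"
    have "\<bar>\<alpha>1 * c\<bar> \<le> 2 * 1" unfolding abs_mult using \<alpha> c_bound by (intro mult_mono) auto
    hence "\<bar>\<alpha>1 * c * s\<bar> \<le> 2 * (\<epsilon> / 3 * (d k + e k))"
      unfolding abs_mult[of _ s] using elim(1) by (intro mult_mono) (auto simp: s_def)
    moreover have "\<alpha>1 * c * d (Suc k) = \<alpha>1 * c * s + \<alpha>1 * c * (1 - \<alpha>1) * d k - \<alpha>1 * \<alpha>2 * c\<^sup>2 * e k"
      by (simp add: s_def algebra_simps power2_eq_square)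
    moreover have "(1 - \<alpha>2 + \<alpha>1 * \<alpha>2 * c\<^sup>2) * e k = (1 - \<alpha>2) * e k + \<alpha>1 * \<alpha>2 * c\<^sup>2 * e k"
      by (simp add: algebra_simps)
    moreover have "- (\<alpha>1 * c * (1 - \<alpha>1)) * d k = - (\<alpha>1 * c * (1 - \<alpha>1) * d k)" by simp
    moreover have "\<epsilon> * (d k + e k) = \<epsilon> / 3 * (d k + e k) + 2 * (\<epsilon> / 3 * (d k + e k))" by simp
    ultimately show ?case using elim(2) by linarith
  qed
qed

lemma normals_obtuse: "c < 0"
proof (rule ccontr)
  assume "\<not> c < 0"
  hence c0: "0 \<le> c" by simp
  define m where "m = min (\<alpha>1 - 1) (\<alpha>2 - 1)"
  have m: "0 < m" "m \<le> \<alpha>1 - 1" "m \<le> \<alpha>2 - 1" using \<alpha> by (auto simp: m_def)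
  \<comment> \<open>Adding the recurrences costs two such errors and still leaves the factor -m/3,
    so the sum of the distances would turn negative.\<close>
  have m3: "0 < m / 3" using m(1) by simp
  from d_recurrence[OF m3] e_recurrence_aux[OF m3] out(1) have "\<forall>\<^sub>F k in sequentially. False"
  proof eventually_elim
    case (elim k)
    have "d k > 0" using elim resid_eq_0_iff[OF B(1) nonempty(2), of "x k"] by (auto simp: d_def)
    hence pos: "0 < m * (d k + e k)" using m(1) nonneg(2)[of k] by simp
    have "d (Suc k) \<le> (1 - \<alpha>1) * d k - \<alpha>2 * c * e k + m / 3 * (d k + e k)"
      using elim(1) unfolding abs_le_iff by (simp add: algebra_simps)
    moreover have "e (Suc k) \<le> (1 - \<alpha>2) * e k - \<alpha>1 * c * d (Suc k) + m / 3 * (d k + e k)"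
      using elim(2) unfolding abs_le_iff by (simp add: algebra_simps)
    moreover have "0 \<le> \<alpha>2 * c * e k" "0 \<le> \<alpha>1 * c * d (Suc k)" using c0 \<alpha> nonneg by auto
    moreover have "(1 - \<alpha>1) * d k \<le> - m * d k" "(1 - \<alpha>2) * e k \<le> - m * e k"
      using m nonneg mult_right_mono[of "1 - \<alpha>1" "- m" "d k"] mult_right_mono[of "1 - \<alpha>2" "- m" "e k"] by simp_all
    ultimately have "d (Suc k) + e (Suc k) \<le> - m * (d k + e k) + 2 * (m / 3 * (d k + e k))"
      by (simp add: algebra_simps)
    thus False using pos nonneg[of "Suc k"] by simp
  qed
  thus False by simp
qed

text \<open>Here -1 < c < 0, so c is nonzero and of modulus below 1. Both characteristic roots are
  then eigenvalues of S_T other than 1, and \<open>gamma_rate\<close> bounds them.\<close>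

lemma decay_transversal:
  assumes "-1 < c" and \<mu>: "gamma_rate (relproj \<alpha>2 {v. a \<bullet> v = 0} \<circ> relproj \<alpha>1 {v. b \<bullet> v = 0}) < \<mu>"
  obtains C where "C > 0" "\<forall>\<^sub>F k in sequentially. d k + e k \<le> C * \<mu> ^ k"
proof -
  obtain l1 l2 where l: "l1 + l2 = complex_of_real (2 - \<alpha>1 - \<alpha>2 + \<alpha>1 * \<alpha>2 * c\<^sup>2)"
    "l1 * l2 = of_real ((1 - \<alpha>1) * (1 - \<alpha>2))" using complex_quadratic_roots .
  have fin: "finite (complex_eigenvalues (hyperplanes_relproj a b \<alpha>1 \<alpha>2))"
    by (rule hyperplanes_relproj_eigenvalues_finite[OF unit(1,2)])
  have g: "gamma_rate (hyperplanes_relproj a b \<alpha>1 \<alpha>2) < \<mu>" using \<mu> by (simp add: hyperplanes_relproj_def[OF unit(1,2)])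
  have lg: "cmod t \<le> gamma_rate (hyperplanes_relproj a b \<alpha>1 \<alpha>2)" if "t = l1 \<or> t = l2" for t
  proof -
    have "(t - l1) * (t - l2) = 0" using that by auto
    hence "t\<^sup>2 - (l1 + l2) * t + l1 * l2 = 0" by (simp add: algebra_simps power2_eq_square)
    hence "t\<^sup>2 - of_real (2 - \<alpha>1 - \<alpha>2 + \<alpha>1 * \<alpha>2 * c\<^sup>2) * t + of_real ((1 - \<alpha>1) * (1 - \<alpha>2)) = 0"
      unfolding l .
    from hyperplanes_relproj_root_eigenvalue[OF unit(1,2) this] normals_obtuse assms(1) \<alpha>
    show ?thesis by (intro gamma_rate_upper[OF fin]) auto
  qed
  obtain C where "C > 0" "\<forall>\<^sub>F k in sequentially. \<bar>d k\<bar> + \<bar>e k\<bar> \<le> C * \<mu> ^ k"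
  proof (rule linear_recurrence_decay[of l1 l2 "1 - \<alpha>1" "1 - \<alpha>2 + \<alpha>1 * \<alpha>2 * c\<^sup>2" "- (\<alpha>2 * c)"
        "- (\<alpha>1 * c * (1 - \<alpha>1))" _ \<mu> d e, OF _ _ lg lg g])
    show "l1 + l2 = complex_of_real (1 - \<alpha>1 + (1 - \<alpha>2 + \<alpha>1 * \<alpha>2 * c\<^sup>2))"
      unfolding l by (simp add: algebra_simps)
    show "l1 * l2 = complex_of_real ((1 - \<alpha>1) * (1 - \<alpha>2 + \<alpha>1 * \<alpha>2 * c\<^sup>2) - - (\<alpha>2 * c) * - (\<alpha>1 * c * (1 - \<alpha>1)))"
      unfolding l of_real_eq_iff by (simp add: algebra_simps power2_eq_square)
  next
    fix \<epsilon> :: real assume "0 < \<epsilon>"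
    from d_recurrence[OF this]
    show "\<forall>\<^sub>F k in sequentially. \<bar>d (Suc k) - ((1 - \<alpha>1) * d k + - (\<alpha>2 * c) * e k)\<bar> \<le> \<epsilon> * (\<bar>d k\<bar> + \<bar>e k\<bar>)"
      using nonneg by simp
    from e_recurrence[OF \<open>0 < \<epsilon>\<close>]
    show "\<forall>\<^sub>F k in sequentially. \<bar>e (Suc k) - (- (\<alpha>1 * c * (1 - \<alpha>1)) * d k
        + (1 - \<alpha>2 + \<alpha>1 * \<alpha>2 * c\<^sup>2) * e k)\<bar> \<le> \<epsilon> * (\<bar>d k\<bar> + \<bar>e k\<bar>)"
      using nonneg by simp
  qed auto
  thus ?thesis using that nonneg by simp
qed

text \<open>Here the two-dimensional recurrence has the spurious characteristic root 1, so \<open>e\<close> is eliminated instead.\<close>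
lemma decay_opposite:
  assumes ab: "a = - b" and foot: "\<forall>\<^sub>F k in sequentially. closest_point B (x k) \<in> A"
    and \<mu>: "gamma_rate (relproj \<alpha>2 {v. a \<bullet> v = 0} \<circ> relproj \<alpha>1 {v. b \<bullet> v = 0}) < \<mu>"
  obtains C where "C > 0" "\<forall>\<^sub>F k in sequentially. d k + e k \<le> C * \<mu> ^ k"
proof -
  define p where "p = (\<alpha>1 - 1) * (\<alpha>2 - 1)"
  have "\<alpha>1 + \<alpha>2 \<noteq> \<alpha>1 * \<alpha>2"
  proof
    assume "\<alpha>1 + \<alpha>2 = \<alpha>1 * \<alpha>2"
    hence "(\<alpha>1 - 1) * (\<alpha>2 - 1) = 1" by (simp add: algebra_simps)
    moreover have "(\<alpha>1 - 1) * (\<alpha>2 - 1) < 1 * 1" using \<alpha> by (intro mult_strict_mono) auto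
    ultimately show False by simp
  qed
  from hyperplanes_relproj_opposite_eigenvalue[OF unit(1,2) ab this]
  have "cmod (of_real ((1 - \<alpha>1) * (1 - \<alpha>2))) \<le> gamma_rate (hyperplanes_relproj a b \<alpha>1 \<alpha>2)"
    by (intro gamma_rate_upper hyperplanes_relproj_eigenvalues_finite[OF unit(1,2)])
  moreover have "cmod (of_real ((1 - \<alpha>1) * (1 - \<alpha>2))) = p"
    unfolding norm_of_real abs_mult using \<alpha> by (simp add: p_def)
  ultimately have p: "p < \<mu>" using \<mu> by (simp add: hyperplanes_relproj_def[OF unit(1,2)])
  have "0 < p" using \<alpha> by (simp add: p_def)
  with p have mu0: "0 < \<mu>" by simp
  have c: "c = -1" using unit by (simp add: ab)
  have foot': "\<forall>\<^sub>F k in sequentially. e k \<le> (\<alpha>1 - 1) * d k"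
    using foot
  proof eventually_elim
    case (elim k)
    have "e k \<le> norm (y k - closest_point B (x k))" unfolding e_def by (rule norm_resid_le[OF A(1) elim])
    also have "y k - closest_point B (x k) = (1 - \<alpha>1) *\<^sub>R resid B (x k)"
      by (simp add: y_def relproj_resid resid_def algebra_simps)
    also have "norm \<dots> = (\<alpha>1 - 1) * d k" using \<alpha> by (simp add: d_def)
    finally show ?case .
  qed
  \<comment> \<open>Since e_k <= d_k eventually, the error is at most (\<mu> - p) d_k, which just
    fills the gap above the main factor \<open>p\<close>.\<close>
  have "0 < (\<mu> - p) / 2" using p by simp
  from d_recurrence[OF this] foot' have "\<forall>\<^sub>F k in sequentially. d (Suc k) \<le> \<mu> * d k"
  proof eventually_elim
    case (elim k)
    have "d (Suc k) \<le> (1 - \<alpha>1) * d k + \<alpha>2 * e k + (\<mu> - p) / 2 * (d k + e k)"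
      using elim(1) unfolding c abs_le_iff by simp
    also have "\<dots> \<le> (1 - \<alpha>1) * d k + \<alpha>2 * ((\<alpha>1 - 1) * d k) + (\<mu> - p) / 2 * (2 * d k)"
    proof (rule add_mono[OF add_mono[OF order_refl mult_left_mono[OF elim(2)]] mult_left_mono])
      have "(\<alpha>1 - 1) * d k \<le> 1 * d k" using \<alpha> nonneg by (intro mult_right_mono) auto
      thus "d k + e k \<le> 2 * d k" using elim(2) by simp
    qed (use \<alpha> p in auto)
    also have "\<dots> = \<mu> * d k" by (simp add: p_def field_simps)
    finally show ?case .
  qed
  from ratio_decay[OF mu0 this] obtain C where C: "C > 0" "\<forall>\<^sub>F k in sequentially. d k \<le> C * \<mu> ^ k" .
  have "\<forall>\<^sub>F k in sequentially. d k + e k \<le> (2 * C) * \<mu> ^ k"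
    using C(2) foot'
  proof eventually_elim
    case (elim k)
    have "(\<alpha>1 - 1) * d k \<le> 1 * d k" using \<alpha> nonneg by (intro mult_right_mono) auto
    thus ?case using elim by simp
  qed
  thus ?thesis using that[of "2 * C"] C(1) by simp
qed

text \<open>The hypothesis on feet is conditional, so that boundary geometry enters only when the
  normals are opposite. Elsewhere the recurrence itself gives the decay.\<close>

lemma linear_rate:
  assumes foot: "a = - b \<Longrightarrow> \<forall>\<^sub>F k in sequentially. closest_point B (x k) \<in> A"
    and \<mu>: "gamma_rate (relproj \<alpha>2 {v. a \<bullet> v = 0} \<circ> relproj \<alpha>1 {v. b \<bullet> v = 0}) < \<mu>" "\<mu> < 1"
  shows "\<exists>C>0. \<forall>k. norm (x k - z) \<le> C * \<mu> ^ k"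
proof -
  have "0 \<le> gamma_rate (hyperplanes_relproj a b \<alpha>1 \<alpha>2)"
    by (intro gamma_rate_nonneg hyperplanes_relproj_eigenvalues_finite[OF unit(1,2)])
  hence mu0: "0 < \<mu>" using \<mu>(1) by (simp add: hyperplanes_relproj_def[OF unit(1,2)])
  obtain C where C: "C > 0" "\<forall>\<^sub>F k in sequentially. d k + e k \<le> C * \<mu> ^ k"
  proof (cases "c = -1")
    case True
    have "(a + b) \<bullet> (a + b) = 0" using True unit by (simp add: inner_add_left inner_add_right inner_commute)
    hence ab: "a = - b" by (simp add: eq_neg_iff_add_eq_0)
    from decay_opposite[OF ab foot[OF ab] \<mu>(1)] that show ?thesis by blast
  next
    case False
    hence "-1 < c" using c_bound by linarith
    from decay_transversal[OF this \<mu>(1)] that show ?thesis by blast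
  qed
  have "\<forall>\<^sub>F k in sequentially. norm (x (Suc k) - x k) \<le> (2 * C) * \<mu> ^ k"
    using C(2)
  proof eventually_elim
    case (elim k)
    thus ?case using norm_x_step[of k] by (simp add: mult.assoc)
  qed
  from geometric_steps_limit[OF lim(1) mu0 \<mu>(2) this] show ?thesis by blast
qed

end

section \<open>Condition (C), identification and the conclusion\<close>

lemma condition_C_smooth:
  fixes A B :: "'a::euclidean_space set"
  assumes A: "closed A" "convex A" "interior A \<noteq> {}" and B: "closed B" "convex B" "interior B \<noteq> {}"
    and C: "condition_C A B z"
  shows "z \<in> interior A \<or> (\<exists>a. smooth_boundary_point A z a \<and> tangent_space (frontier A) z = {v. a \<bullet> v = 0})"
    and "z \<in> interior B \<or> (\<exists>b. smooth_boundary_point B z b \<and> tangent_space (frontier B) z = {v. b \<bullet> v = 0})"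
proof -
  have "z \<in> interior A \<or> z \<in> frontier A \<and> C2_manifold_around (frontier A) z"
    using C unfolding condition_C_def regularity_assumption_def by auto
  thus "z \<in> interior A \<or> (\<exists>a. smooth_boundary_point A z a \<and> tangent_space (frontier A) z = {v. a \<bullet> v = 0})"
    by (elim disjE conjE) (simp, metis C2_frontier_smooth[OF A])
  have "z \<in> interior B \<or> z \<in> frontier B \<and> C2_manifold_around (frontier B) z"
    using C unfolding condition_C_def regularity_assumption_def by auto
  thus "z \<in> interior B \<or> (\<exists>b. smooth_boundary_point B z b \<and> tangent_space (frontier B) z = {v. b \<bullet> v = 0})"
    by (elim disjE conjE) (simp, metis C2_frontier_smooth[OF B])
qed

lemma overshoot_near_smooth_or_interior_point:
  fixes C :: "'a::euclidean_space set"
  assumes C: "closed C" "convex C" "interior C \<noteq> {}" and \<alpha>: "1 \<le> \<alpha>"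
    and z: "z \<in> interior C \<or> (\<exists>n. smooth_boundary_point C z n)"
  shows "\<forall>\<^sub>F w in nhds z. relproj \<alpha> C w \<in> C"
  using z
proof
  assume "z \<in> interior C"
  hence "\<forall>\<^sub>F w in nhds z. w \<in> interior C" by (intro eventually_nhds_in_open open_interior)
  thus ?thesis
  proof eventually_elim
    case (elim w)
    hence "w \<in> C" using interior_subset by blast
    thus ?case by (simp add: relproj_id)
  qed
next
  assume "\<exists>n. smooth_boundary_point C z n"
  thus ?thesis using overshoot_near_smooth_point[OF C _ \<alpha>] by blast
qed

theorem theorem8:
  fixes A B :: "'a::euclidean_space set" and x :: "nat \<Rightarrow> 'a" and \<alpha>1 \<alpha>2 :: real
  assumes "closed A" "convex A" "interior A \<noteq> {}"
    and "closed B" "convex B" "interior B \<noteq> {}"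
    and "A \<inter> B \<noteq> {}"
    and "1 < \<alpha>1" "\<alpha>1 < 2" "1 < \<alpha>2" "\<alpha>2 < 2"
    and iter: "\<And>k. x (Suc k) = relproj \<alpha>2 A (relproj \<alpha>1 B (x k))"
  shows "\<exists>xs \<in> A \<inter> B. x \<longlonglongrightarrow> xs \<and>
     (condition_C A B xs \<longrightarrow>
        (\<exists>k. x k \<in> A \<inter> B) \<or>
        (xs \<in> frontier A \<inter> frontier B \<and>
         (\<exists>K. \<forall>k\<ge>K. relproj \<alpha>1 B (x k) \<in> relproj_set \<alpha>1 (frontier B) (x k) \<and>
                     x (Suc k) \<in> relproj_set \<alpha>2 (frontier A) (relproj \<alpha>1 B (x k))) \<and>
         (\<forall>\<mu>. gamma_rate (relproj \<alpha>2 (tangent_space (frontier A) xs) \<circ>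
                           relproj \<alpha>1 (tangent_space (frontier B) xs)) < \<mu> \<and> \<mu> < 1 \<longrightarrow>
              (\<exists>C>0. \<forall>k. norm (x k - xs) \<le> C * \<mu> ^ k))))"
proof -
  note A = assms(1-3) and B = assms(4-6) and \<alpha> = assms(8-11)
  have ne: "A \<noteq> {}" "B \<noteq> {}" using assms(7) by auto
  define y where "y k = relproj \<alpha>1 B (x k)" for k
  have xy: "x (Suc k) = relproj \<alpha>2 A (y k)" for k by (simp add: y_def iter)
  obtain xs where xs: "xs \<in> A" "xs \<in> B" "x \<longlonglongrightarrow> xs" "y \<longlonglongrightarrow> xs"
    using alternating_relproj_converges[OF A(1,2) B(1,2) assms(7), of \<alpha>1 \<alpha>2 x] \<alpha> iter
    unfolding y_def[abs_def] by auto
  have "(\<exists>k. x k \<in> A \<inter> B) \<or>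
        (xs \<in> frontier A \<inter> frontier B \<and>
         (\<exists>K. \<forall>k\<ge>K. relproj \<alpha>1 B (x k) \<in> relproj_set \<alpha>1 (frontier B) (x k) \<and>
                     x (Suc k) \<in> relproj_set \<alpha>2 (frontier A) (relproj \<alpha>1 B (x k))) \<and>
         (\<forall>\<mu>. gamma_rate (relproj \<alpha>2 (tangent_space (frontier A) xs) \<circ>
                           relproj \<alpha>1 (tangent_space (frontier B) xs)) < \<mu> \<and> \<mu> < 1 \<longrightarrow>
              (\<exists>C>0. \<forall>k. norm (x k - xs) \<le> C * \<mu> ^ k)))"
    if C: "condition_C A B xs"
  proof (rule disjCI)
    assume "\<not> (xs \<in> frontier A \<inter> frontier B \<and>
         (\<exists>K. \<forall>k\<ge>K. relproj \<alpha>1 B (x k) \<in> relproj_set \<alpha>1 (frontier B) (x k) \<and>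
                     x (Suc k) \<in> relproj_set \<alpha>2 (frontier A) (relproj \<alpha>1 B (x k))) \<and>
         (\<forall>\<mu>. gamma_rate (relproj \<alpha>2 (tangent_space (frontier A) xs) \<circ>
                           relproj \<alpha>1 (tangent_space (frontier B) xs)) < \<mu> \<and> \<mu> < 1 \<longrightarrow>
              (\<exists>C>0. \<forall>k. norm (x k - xs) \<le> C * \<mu> ^ k)))" (is "\<not> ?R")
    show "\<exists>k. x k \<in> A \<inter> B"
    proof (rule ccontr)
      assume nofin: "\<nexists>k. x k \<in> A \<inter> B"
      note smooth = condition_C_smooth[OF A B C]
      have smooth': "xs \<in> interior A \<or> (\<exists>a. smooth_boundary_point A xs a)"
        "xs \<in> interior B \<or> (\<exists>b. smooth_boundary_point B xs b)" using smooth by blast+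
      have "\<forall>\<^sub>F k in sequentially. x (Suc k) \<in> A"
        using overshoot_near_smooth_or_interior_point[OF A less_imp_le[OF \<alpha>(3)] smooth'(1)] xs(4)
        unfolding xy by (rule eventually_compose_filterlim)
      hence xA: "\<forall>\<^sub>F k in sequentially. x k \<in> A"
        using eventually_sequentially_Suc[of "\<lambda>k. x k \<in> A"] by simp
      have yB: "\<forall>\<^sub>F k in sequentially. y k \<in> B"
        using overshoot_near_smooth_or_interior_point[OF B less_imp_le[OF \<alpha>(1)] smooth'(2)] xs(3)
        unfolding y_def by (rule eventually_compose_filterlim)
      have xB: "\<forall>\<^sub>F k in sequentially. x k \<notin> B"
        using xA by eventually_elim (use nofin in auto)
      \<comment> \<open>Since \<open>y k\<close> is in \<open>B\<close>, membership in
        \<open>A\<close> would make the second step trivial, and \<open>x (Suc k) = y k\<close>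
        would solve the problem.\<close>
      have yA: "\<forall>\<^sub>F k in sequentially. y k \<notin> A"
        using yB
      proof eventually_elim
        case (elim k)
        show ?case
        proof
          assume "y k \<in> A"
          hence "x (Suc k) = y k" by (simp add: xy relproj_id)
          thus False using nofin elim \<open>y k \<in> A\<close> by (metis IntI)
        qed
      qed
      have "xs \<notin> interior B"
      proof
        assume "xs \<in> interior B"
        from topological_tendstoD[OF xs(3) open_interior this] xB
        have "\<forall>\<^sub>F k in sequentially. False" by eventually_elim (use interior_subset in blast)
        thus False by simp
      qed
      moreover have "xs \<notin> interior A"
      proof
        assume "xs \<in> interior A"
        from topological_tendstoD[OF xs(4) open_interior this] yA
        have "\<forall>\<^sub>F k in sequentially. False" by eventually_elim (use interior_subset in blast)
        thus False by simp
      qed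
      \<comment> \<open>The limit is interior to neither set, which leaves (C1) alone and with it
        the regularity assumption.\<close>
      ultimately obtain a b where a: "smooth_boundary_point A xs a" "tangent_space (frontier A) xs = {v. a \<bullet> v = 0}"
        and b: "smooth_boundary_point B xs b" "tangent_space (frontier B) xs = {v. b \<bullet> v = 0}"
        and reg: "regularity_assumption (frontier A) (frontier B) xs"
        using smooth C unfolding condition_C_def by blast
      have fr: "xs \<in> frontier A \<inter> frontier B" using a b by (simp add: smooth_boundary_point_def)
      interpret rate: alternating_relproj A B x \<alpha>1 \<alpha>2 xs a b
        by unfold_locales (use A B \<alpha> iter a b xs xB yA in \<open>simp_all add: y_def[abs_def]\<close>)
      have ident: "\<forall>\<^sub>F k in sequentially. relproj \<alpha>1 B (x k) \<in> relproj_set \<alpha>1 (frontier B) (x k) \<and>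
                     x (Suc k) \<in> relproj_set \<alpha>2 (frontier A) (relproj \<alpha>1 B (x k))"
        using xB yA
      proof eventually_elim
        case (elim k)
        show ?case
          using relproj_in_relproj_set_frontier[OF B(1,2) ne(2) elim(1), of \<alpha>1]
            relproj_in_relproj_set_frontier[OF A(1,2) ne(1) elim(2), of \<alpha>2]
          unfolding xy y_def by blast
      qed
      \<comment> \<open>Opposite normals have the same orthogonal complement, so by regularity it is
        also the tangent space of the intersection of the boundaries.\<close>
      have foot: "\<forall>\<^sub>F k in sequentially. closest_point B (x k) \<in> A" if ab: "a = - b"
      proof -
        have "tangent_space (frontier A \<inter> frontier B) xs = {v. b \<bullet> v = 0}"
          using reg a(2) b(2) by (auto simp: regularity_assumption_def ab)
        moreover have "C2_manifold_around (frontier A \<inter> frontier B) xs"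
          using reg by (simp add: regularity_assumption_def)
        ultimately have "\<forall>\<^sub>F p in nhds xs. p \<in> frontier B \<longrightarrow> p \<in> frontier A \<inter> frontier B"
          using fr by (intro frontier_near_subset_of_tangent_manifold[OF B b(1)]) auto
        moreover have "(\<lambda>k. closest_point B (x k)) \<longlonglongrightarrow> xs"
          using isCont_tendsto_compose[OF continuous_at_closest_point[OF B(2,1) ne(2)] xs(3)]
          by (simp add: closest_point_self[OF xs(2)])
        ultimately have "\<forall>\<^sub>F k in sequentially. closest_point B (x k) \<in> frontier B \<longrightarrow>
            closest_point B (x k) \<in> frontier A \<inter> frontier B"
          by (rule eventually_compose_filterlim)
        with xB show ?thesis
        proof eventually_elim
          case (elim k)
          have "closest_point B (x k) \<in> frontier B"
            by (rule closest_point_in_frontier[OF B(1,2) ne(2) elim(1)])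
          thus ?case using elim(2) A(1) frontier_subset_closed by blast
        qed
      qed
      have ?R
      proof (intro conjI allI impI)
        show "xs \<in> frontier A \<inter> frontier B" by (rule fr)
        show "\<exists>K. \<forall>k\<ge>K. relproj \<alpha>1 B (x k) \<in> relproj_set \<alpha>1 (frontier B) (x k) \<and>
                     x (Suc k) \<in> relproj_set \<alpha>2 (frontier A) (relproj \<alpha>1 B (x k))"
          using ident by (simp add: eventually_sequentially)
      next
        fix \<mu> assume "gamma_rate (relproj \<alpha>2 (tangent_space (frontier A) xs) \<circ>
                           relproj \<alpha>1 (tangent_space (frontier B) xs)) < \<mu> \<and> \<mu> < 1"
        thus "\<exists>C>0. \<forall>k. norm (x k - xs) \<le> C * \<mu> ^ k"
          unfolding a(2) b(2) using rate.linear_rate[OF foot] by blast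
      qed
      with \<open>\<not> ?R\<close> show False by contradiction
    qed
  qed
  with xs show ?thesis by blast
qed

end
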